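(* Let $A\in M_n(\mathbb R)$ be generic and such that $1\notin\mathrm{Spec}^a(A)$. Then the degree of $F_A$ is well-defined and it satisfies $$\deg F_A = 1-\sum_{(\lambda,S)}\operatorname{sign}\bigl(\chi_{SA}'(\lambda)\bigr),$$ where the sum runs over all pairs $(\lambda,S)$ with $\lambda>1$ real and $S\in\mathcal S_n$ for which there exists $x\in\mathbb R^n_{>0}$ with $SAx=\lambda x$, and $\chi_{SA}$ denotes the characteristic polynomial of $SA$.
   Context: $M_n(\mathbb R)$ is the space of real $n\times n$ matrices and $|\cdot|$ denotes the componentwise absolute value on $\mathbb R^n$. For $A\in M_n(\mathbb R)$ let $F_A:\mathbb R^n\to\mathbb R^n$, $F_A(z)=z-A|z|$. $\mathcal S_n$ is the set of sign matrices, i.e. diagonal $n\times n$ matrices with all diagonal entries in $\{-1,+1\}$. The characteristic polynomial of $B\in M_n(\mathbb R)$ is $\chi_B(T)=\det(T\,\mathbb I-B)$, and $\chi_B'$ is its derivative. $\mathbb R^n_{>0}$ is the set of vectors with all entries positive. An aligned trio of $A$ is a triple $(\lambda,S,v)$ with $\lambda\ge 0$ real, $S\in\mathcal S_n$, $v\in\mathbb R^n_{\ge 0}$, $\|v\|_2=1$, and $SAv=\lambda v$. Then $\lambda$ is called an aligned value of $A$. The aligned spectrum $\mathrm{Spec}^a(A)$ is the set of aligned values of $A$. $A$ is generic if for every aligned trio $(\lambda,S,v)$ of $A$, $\lambda$ is a simple eigenvalue of $SA$ and $v$ is strictly positive (all entries $>0$). If $F_A$ is nondegenerate (i.e. $F_A(z)=0$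 only for $z=0$), the degree of $F_A$ is $\deg F_A:=\deg \bar F_A$, the topological degree of the continuous map $\bar F_A:\mathbb S^{n-1}\to\mathbb S^{n-1}$, $\bar F_A(x)=F_A(x)/\|F_A(x)\|_2$ (defined via reduced homology if $n=1$). "The degree is well-defined" means that $F_A$ is nondegenerate. *)

theory Defs
  imports "HOL-Homology.Homology" "Jordan_Normal_Form.Char_Poly"
begin

unbundle no vec_syntax

definition nonneg_vecs :: "nat \<Rightarrow> real vec set"
  where "nonneg_vecs n = {v \<in> carrier_vec n. \<forall>i<n. 0 \<le> v $ i}"

definition pos_vecs :: "nat \<Rightarrow> real vec set"
  where "pos_vecs n = {v \<in> carrier_vec n. \<forall>i<n. 0 < v $ i}"

definition sign_mats :: "nat \<Rightarrow> real mat set"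
  where "sign_mats n = {S \<in> carrier_mat n n. diagonal_mat S \<and> (\<forall>i<n. S $$ (i, i) \<in> {- 1, 1})}"

definition norm2 :: "real vec \<Rightarrow> real"
  where "norm2 v = L2_set (vec_index v) {..<dim_vec v}"

definition aligned_trio :: "real mat \<Rightarrow> real \<Rightarrow> real mat \<Rightarrow> real vec \<Rightarrow> bool"
  where "aligned_trio A \<mu> S v \<longleftrightarrow>
     0 \<le> \<mu> \<and> S \<in> sign_mats (dim_row A) \<and> v \<in> nonneg_vecs (dim_row A) \<and> norm2 v = 1 \<and>
     (S * A) *\<^sub>v v = \<mu> \<cdot>\<^sub>v v"

definition aligned_spectrum :: "real mat \<Rightarrow> real set"
  where "aligned_spectrum A = {\<mu>. \<exists>S v. aligned_trio A \<mu> S v}"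

text \<open>A simple eigenvalue is one of algebraic multiplicity one.\<close>

definition simple_eigenvalue :: "real mat \<Rightarrow> real \<Rightarrow> bool"
  where "simple_eigenvalue B \<mu> \<longleftrightarrow> order \<mu> (char_poly B) = 1"

definition generic :: "real mat \<Rightarrow> bool"
  where "generic A \<longleftrightarrow>
     (\<forall>\<mu> S v. aligned_trio A \<mu> S v \<longrightarrow> simple_eigenvalue (S * A) \<mu> \<and> v \<in> pos_vecs (dim_row A))"

definition F_map :: "real mat \<Rightarrow> real vec \<Rightarrow> real vec"
  where "F_map A z = z - A *\<^sub>v map_vec abs z"

definition nondegenerate_F :: "real mat \<Rightarrow> bool"
  where "nondegenerate_F A \<longleftrightarrow>
     (\<forall>z \<in> carrier_vec (dim_row A). F_map A z = 0\<^sub>v (dim_row A) \<longrightarrow> z = 0\<^sub>v (dim_row A))"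

text \<open>
  The normalised map on the unit sphere of \<open>\<real>\<^sup>n\<close>, transported to the representation used by
  \<^const>\<open>nsphere\<close>: points are functions on \<^typ>\<open>nat\<close> that vanish from index \<open>n\<close> on.
\<close>

definition F_sphere_map :: "real mat \<Rightarrow> (nat \<Rightarrow> real) \<Rightarrow> nat \<Rightarrow> real"
  where "F_sphere_map A x =
     (let w = F_map A (vec (dim_row A) x)
      in (\<lambda>i. if i < dim_row A then w $ i / norm2 w else 0))"

text \<open>
  \<^term>\<open>nsphere (n - 1)\<close> is the unit sphere of \<open>\<real>\<^sup>n\<close>, for \<open>n \<ge> 1\<close>. \<^const>\<open>Brouwer_degree2\<close> is defined
  by reduced homology in every dimension, including \<open>n = 1\<close>.  The value is only meaningful under
  \<^const>\<open>nondegenerate_F\<close>; see \<open>continuous_map_F_sphere_map\<close> below.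
\<close>

definition deg_F :: "real mat \<Rightarrow> int"
  where "deg_F A = Brouwer_degree2 (dim_row A - 1) (F_sphere_map A)"

definition expanding_pairs :: "real mat \<Rightarrow> (real \<times> real mat) set"
  where "expanding_pairs A =
     {(\<mu>, S). 1 < \<mu> \<and> S \<in> sign_mats (dim_row A) \<and>
        (\<exists>x \<in> pos_vecs (dim_row A). (S * A) *\<^sub>v x = \<mu> \<cdot>\<^sub>v x)}"

lemma finite_sign_mats: "finite (sign_mats n)"
proof -
  let ?D = "\<lambda>f :: nat \<Rightarrow> real. mat n n (\<lambda>(i, j). if i = j then f i else 0)"
  have "sign_mats n \<subseteq> ?D ` ({..<n} \<rightarrow>\<^sub>E {- 1, 1})"
  proof
    fix S assume S: "S \<in> sign_mats n"
    have "S = ?D (\<lambda>i\<in>{..<n}. S $$ (i, i))"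
      using S by (intro eq_matI) (auto simp: sign_mats_def diagonal_mat_def)
    moreover have "(\<lambda>i\<in>{..<n}. S $$ (i, i)) \<in> {..<n} \<rightarrow>\<^sub>E {- 1, 1}"
      using S by (auto simp: sign_mats_def)
    ultimately show "S \<in> ?D ` ({..<n} \<rightarrow>\<^sub>E {- 1, 1})"
      by blast
  qed
  then show ?thesis
    by (rule finite_subset) (intro finite_imageI finite_PiE; simp)
qed

lemma finite_expanding_pairs:
  assumes A: "A \<in> carrier_mat n n" and n: "0 < n"
  shows "finite (expanding_pairs A)"
proof (rule finite_subset)
  let ?E = "\<lambda>S. {\<mu>. eigenvalue (S * A) \<mu>}"
  show "expanding_pairs A \<subseteq> (\<Union>S\<in>sign_mats n. ?E S \<times> {S})"
  proof
    fix p assume "p \<in> expanding_pairs A"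
    then obtain \<mu> S x where p: "p = (\<mu>, S)" and S: "S \<in> sign_mats n"
      and x: "x \<in> pos_vecs n" "(S * A) *\<^sub>v x = \<mu> \<cdot>\<^sub>v x"
      using A by (auto simp: expanding_pairs_def)
    have "x \<noteq> 0\<^sub>v n"
      using x(1) n by (auto simp: pos_vecs_def)
    moreover have "S \<in> carrier_mat n n"
      using S by (simp add: sign_mats_def)
    ultimately have "eigenvalue (S * A) \<mu>"
      using x by (auto simp: eigenvalue_def eigenvector_def pos_vecs_def)
    then show "p \<in> (\<Union>S\<in>sign_mats n. ?E S \<times> {S})"
      using p S by blast
  qed
  have "finite (?E S)" if "S \<in> sign_mats n" for S
  proof -
    have SA: "S * A \<in> carrier_mat n n"
      using that A by (auto simp: sign_mats_def)
    then have "char_poly (S * A) \<noteq> 0"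
      using degree_monic_char_poly[OF SA] by auto
    then show ?thesis
      using eigenvalue_root_char_poly[OF SA] poly_roots_finite by auto
  qed
  then show "finite (\<Union>S\<in>sign_mats n. ?E S \<times> {S})"
    using finite_sign_mats by (intro finite_UN_I) auto
qed

lemma continuous_map_F_sphere_map:
  assumes A: "A \<in> carrier_mat n n" and n: "0 < n" and nd: "nondegenerate_F A"
  shows "continuous_map (nsphere (n - 1)) (nsphere (n - 1)) (F_sphere_map A)"
proof -
  define g :: "nat \<Rightarrow> (nat \<Rightarrow> real) \<Rightarrow> real"
    where "g i x = x i - (\<Sum>j<n. A $$ (i, j) * \<bar>x j\<bar>)" for i x
  define N where "N x = sqrt (\<Sum>i<n. (g i x)\<^sup>2)" for x
  have F: "F_map A (vec n x) $ i = g i x" if "i < n" for i x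
    using that A by (auto simp: F_map_def g_def scalar_prod_def lessThan_atLeast0 intro!: sum.cong)
  have dimF: "dim_vec (F_map A (vec n x)) = n" for x
    using A by (simp add: F_map_def)
  have norm: "norm2 (F_map A (vec n x)) = N x" for x
    by (simp add: norm2_def L2_set_def N_def dimF F)
  have eq: "F_sphere_map A x = (\<lambda>i. if i < n then g i x / N x else 0)" for x
    using A by (auto simp: F_sphere_map_def Let_def norm F)
  have set_eq: "{..n - 1} = {..<n}" and Suc_n: "Suc (n - 1) = n"
    using n by auto
  have N_pos: "0 < N x" if x: "x \<in> topspace (nsphere (n - 1))" for x
  proof -
    have "(\<Sum>i<n. (x i)\<^sup>2) = 1"
      using x set_eq by (simp add: nsphere)
    then obtain j where j: "j < n" "x j \<noteq> 0"
      by (metis (no_types, lifting) lessThan_iff sum.neutral zero_neq_one zero_power2)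
    then have "vec n x \<noteq> 0\<^sub>v n"
      by (metis index_vec index_zero_vec(1))
    then have "F_map A (vec n x) \<noteq> 0\<^sub>v n"
      using nd A unfolding nondegenerate_F_def by auto
    then obtain i where "i < n" "g i x \<noteq> 0"
      using dimF F by (metis eq_vecI index_zero_vec(1) index_zero_vec(2))
    then have "0 < (\<Sum>i<n. (g i x)\<^sup>2)"
      by (intro sum_pos2[of _ i]) auto
    then show ?thesis
      by (simp add: N_def)
  qed
  have cg: "continuous_map (nsphere (n - 1)) euclideanreal (g i)" for i
    unfolding g_def
    by (intro continuous_map_diff continuous_map_sum continuous_map_real_mult_left
        continuous_map_real_abs continuous_map_nsphere_projection) auto
  have cN: "continuous_map (nsphere (n - 1)) euclideanreal N"
    unfolding N_def
    by (intro continuous_map_sqrt continuous_map_sum continuous_map_real_pow cg) auto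
  have cont: "continuous_map (nsphere (n - 1)) euclideanreal (\<lambda>x. g i x / N x)" for i
    using N_pos by (intro continuous_map_real_divide cg cN) fastforce
  have "continuous_map (nsphere (n - 1)) (Euclidean_space n) (F_sphere_map A)"
    using cont unfolding eq[abs_def]
    by (subst continuous_map_componentwise_Euclidean_space) auto
  moreover have "(\<Sum>i<n. (F_sphere_map A x i)\<^sup>2) = 1" if "x \<in> topspace (nsphere (n - 1))" for x
  proof -
    have "(\<Sum>i<n. (F_sphere_map A x i)\<^sup>2) = (\<Sum>i<n. (g i x)\<^sup>2) / (N x)\<^sup>2"
      by (simp add: eq power_divide sum_divide_distrib)
    also have "(\<Sum>i<n. (g i x)\<^sup>2) = (N x)\<^sup>2"
      by (simp add: N_def sum_nonneg)
    finally show ?thesis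
      using N_pos[OF that] by simp
  qed
  ultimately show ?thesis
    by (subst (2) nsphere_def) (auto simp del: One_nat_def simp: continuous_map_in_subtopology set_eq Suc_n)
qed

end

(* For a continuous function tau from the sphere to [0,1] consider x |-> x - tau(x) A|x|. Such a map
   vanishes exactly at the points x_e = S v (normalised) with tau(x_e) = 1/mu, one for each expanding
   pair e = (mu, S). Genericity makes these points pairwise distinct, so by straight-line homotopies
   the degree depends only on the set of those e with tau(x_e) > 1/mu, and the pairs can be crossed one
   at a time, starting from tau = 0 (the identity) and ending at tau = 1 (the map F_A).

   The degree jump at a crossing is found by locality: if f1, g1 differ only inside an open set U and
   f2, g2 coincide there with f1, g1 and agree elsewhere, then deg f1 - deg g1 = deg f2 - deg g2, since
   a fundamental cycle can be subdivided subordinately to a cover. Near x_e the map is linear,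
   x |-> x - tau(x) A S x, which extends to the whole sphere. Before the crossing the extension is the
   linear map 1 - t A S with 1/t slightly above mu, of degree sgn det (1 - t A S) = sgn chi'(mu). After
   pushing tau beyond 1/mu at x_e only, the map misses the direction of x_e, because mu is a simple
   eigenvalue, so its degree is 0. *)

theory Submission
  imports Defs
begin

subsection \<open>Locality of the Brouwer degree\<close>

lemma homologous_rel_set_mult:
  "homologous_rel_set p X S a \<otimes>\<^bsub>relative_homology_group (int p) X S\<^esub> homologous_rel_set p X S b
    = homologous_rel_set p X S (a + b)"
proof -
  have "\<exists>r. homologous_rel p X S a r \<and> (\<exists>s. homologous_rel p X S b s \<and> c = r + s)"
    if c: "homologous_rel p X S (a + b) c" for c
  proof (intro exI conjI)
    show "homologous_rel p X S b (c - a)"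
      using homologous_rel_diff[OF c homologous_rel_refl[of p X S a]] by simp
  qed auto
  then show ?thesis
    unfolding mult_relative_homology_group by (auto intro: homologous_rel_add)
qed

text \<open>It suffices to look at a single simplex. On one inside \<open>U\<close> the pairs
  \<open>f1\<close>, \<open>f2\<close> and \<open>g1\<close>, \<open>g2\<close> have equal images,
  on one inside \<open>W\<close> the pairs \<open>f1\<close>, \<open>g1\<close> and
  \<open>f2\<close>, \<open>g2\<close> do; in either case both sides consist of the same two
  summands.\<close>

lemma chain_map_add_eq_local:
  assumes small: "\<And>s. s \<in> Poly_Mapping.keys c \<Longrightarrow> s \<in> standard_simplex p \<rightarrow> U \<or> s \<in> standard_simplex p \<rightarrow> W"
    and U: "\<And>x. x \<in> U \<Longrightarrow> f1 x = f2 x" "\<And>x. x \<in> U \<Longrightarrow> g1 x = g2 x"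
    and W: "\<And>x. x \<in> W \<Longrightarrow> f1 x = g1 x" "\<And>x. x \<in> W \<Longrightarrow> f2 x = g2 x"
  shows "chain_map p f1 c + chain_map p g2 c = chain_map p f2 c + chain_map p g1 c"
proof -
  have "Poly_Mapping.keys c \<subseteq> {s. s \<in> standard_simplex p \<rightarrow> U \<or> s \<in> standard_simplex p \<rightarrow> W}"
    using small by auto
  then show ?thesis
  proof (induction c rule: frag_induction)
    case (one s)
    have eq: "simplex_map p f s = simplex_map p g s"
      if "s \<in> standard_simplex p \<rightarrow> T" "\<And>x. x \<in> T \<Longrightarrow> f x = g x" for T and f g :: "'a \<Rightarrow> 'b"
      using that by (auto simp: simplex_map_def restrict_def Pi_iff)
    have "simplex_map p f1 s = simplex_map p f2 s \<and> simplex_map p g1 s = simplex_map p g2 s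
      \<or> simplex_map p f1 s = simplex_map p g1 s \<and> simplex_map p f2 s = simplex_map p g2 s"
      using one eq[of U f1 f2] eq[of U g1 g2] eq[of W f1 g1] eq[of W f2 g2] U W by blast
    then show ?case
      by (auto simp: add.commute)
  qed (auto simp: chain_map_diff algebra_simps)
qed

text \<open>The degrees are read off as exponents of a generator \<open>a\<close> of the reduced
  homology. Once \<open>a\<close> is represented by a cycle of small simplices, the chain identity
  above becomes an equation between powers of \<open>a\<close>.\<close>

proposition Brouwer_degree2_local:
  fixes f1 f2 g1 g2 :: "(nat \<Rightarrow> real) \<Rightarrow> nat \<Rightarrow> real"
  assumes cont: "continuous_map (nsphere p) (nsphere p) f1" "continuous_map (nsphere p) (nsphere p) g1"
      "continuous_map (nsphere p) (nsphere p) f2" "continuous_map (nsphere p) (nsphere p) g2"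
    and opn: "openin (nsphere p) U" "openin (nsphere p) W" "topspace (nsphere p) \<subseteq> U \<union> W"
    and U: "\<And>x. x \<in> U \<Longrightarrow> f1 x = f2 x" "\<And>x. x \<in> U \<Longrightarrow> g1 x = g2 x"
    and W: "\<And>x. x \<in> W \<Longrightarrow> f1 x = g1 x" "\<And>x. x \<in> W \<Longrightarrow> f2 x = g2 x"
  shows "Brouwer_degree2 p f1 - Brouwer_degree2 p g1 = Brouwer_degree2 p f2 - Brouwer_degree2 p g2"
proof -
  let ?X = "nsphere p" and ?G = "reduced_homology_group (int p) (nsphere p)"
    and ?H = "homology_group (int p) (nsphere p)"
  interpret group ?G
    by simp
  obtain a where a: "a \<in> carrier ?G" and aeq: "subgroup_generated ?G {a} = ?G"
    using cyclic_reduced_homology_group_nsphere [of p p] by (auto simp: cyclic_group_def)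
  \<comment> \<open>The group is infinite cyclic, so equal powers of \<open>a\<close> have equal
    exponents; the last step relies on this.\<close>
  have ord: "ord a = 0"
    by (simp add: a aeq iso_finite [OF reduced_homology_group_nsphere(1)] flip: infinite_cyclic_subgroup_order)
  have "a \<in> carrier ?H"
    using a carrier_reduced_homology_group_subset by blast
  then obtain c where c: "singular_relcycle p ?X {} c" "a = homologous_rel_set p ?X {} c"
    by (auto simp: carrier_relative_homology_group)
  \<comment> \<open>Subdivision of \<open>c\<close>: a homologous cycle each of whose simplices lies
    in \<open>U\<close> or in \<open>W\<close>.\<close>
  obtain c' where c': "singular_relcycle p ?X {} c'" "homologous_rel p ?X {} c c'"
    and small: "\<And>f. f \<in> Poly_Mapping.keys c' \<Longrightarrow> \<exists>V \<in> {U, W}. f \<in> standard_simplex p \<rightarrow> V"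
  proof (rule small_homologous_rel_relcycle_exists[of "{U, W}" ?X p "{}" c])
    show "openin ?X V" if "V \<in> {U, W}" for V
      using that opn by auto
  qed (use opn c(1) in auto)
  have a': "a = homologous_rel_set p ?X {} c'"
    using c c'(2) homologous_rel_set_eq by metis
  have pow: "a [^]\<^bsub>?G\<^esub> Brouwer_degree2 p f = homologous_rel_set p ?X {} (chain_map p f c')"
    if "continuous_map ?X ?X f" for f
    using Brouwer_degree2[OF a, of f] hom_induced_chain_map[OF that _ c'(1), of "{}"] a' by simp
  have mult: "(\<otimes>\<^bsub>?G\<^esub>) = (\<otimes>\<^bsub>?H\<^esub>)"
    by (simp add: reduced_homology_group_def)
  have "chain_map p f1 c' + chain_map p g2 c' = chain_map p f2 c' + chain_map p g1 c'"
    using chain_map_add_eq_local[of c' p U W f1 f2 g1 g2] U W small by auto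
  then have "a [^]\<^bsub>?G\<^esub> (Brouwer_degree2 p f1 + Brouwer_degree2 p g2)
      = a [^]\<^bsub>?G\<^esub> (Brouwer_degree2 p f2 + Brouwer_degree2 p g1)"
    using a by (simp add: int_pow_mult pow cont mult homologous_rel_set_mult)
  then show ?thesis
    using a ord by (simp add: int_pow_eq)
qed

subsection \<open>Degree of nonvanishing vector-valued maps on the sphere\<close>

text \<open>The domain type is left open so that homotopies, whose argument is a pair, can be
  normalised too. Coordinates beyond \<open>p\<close> are set to 0 because the points of
  \<open>nsphere p\<close> vanish there.\<close>

definition normalise :: "nat \<Rightarrow> ('a \<Rightarrow> nat \<Rightarrow> real) \<Rightarrow> 'a \<Rightarrow> nat \<Rightarrow> real"
  where "normalise p g x = (\<lambda>i. if i \<le> p then g x i / L2_set (g x) {..p} else 0)"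

text \<open>Coordinates beyond \<open>p\<close> are left unconstrained, which allows maps to be
  given by plain formulas in \<open>x i\<close>.\<close>

definition admissible :: "nat \<Rightarrow> ((nat \<Rightarrow> real) \<Rightarrow> nat \<Rightarrow> real) \<Rightarrow> bool"
  where "admissible p g \<longleftrightarrow>
    (\<forall>i\<le>p. continuous_map (nsphere p) euclideanreal (\<lambda>x. g x i)) \<and>
    (\<forall>x \<in> topspace (nsphere p). \<exists>i\<le>p. g x i \<noteq> 0)"

definition degree_of :: "nat \<Rightarrow> ((nat \<Rightarrow> real) \<Rightarrow> nat \<Rightarrow> real) \<Rightarrow> int"
  where "degree_of p g = Brouwer_degree2 p (normalise p g)"

lemma in_nsphere_iff:
  "x \<in> topspace (nsphere p) \<longleftrightarrow> (\<Sum>i\<le>p. (x i)\<^sup>2) = 1 \<and> (\<forall>i>p. x i = 0)"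
  by (simp add: nsphere)

lemma L2_set_atMost_pos:
  assumes "i \<le> p" "v i \<noteq> 0"
  shows "0 < L2_set v {..p::nat}"
proof -
  have "L2_set v {..p} \<noteq> 0"
    using assms by (subst L2_set_eq_0_iff) auto
  then show ?thesis
    by (metis L2_set_nonneg less_eq_real_def)
qed

lemma admissibleD:
  assumes "admissible p g"
  shows "i \<le> p \<Longrightarrow> continuous_map (nsphere p) euclideanreal (\<lambda>x. g x i)"
    and "x \<in> topspace (nsphere p) \<Longrightarrow> 0 < L2_set (g x) {..p}"
  using assms L2_set_atMost_pos unfolding admissible_def by blast+

text \<open>The space \<open>X\<close> is arbitrary in order to cover both the sphere and its
  product with [0,1].\<close>

lemma continuous_map_normalise_gen:
  assumes g: "\<And>i. i \<le> p \<Longrightarrow> continuous_map X euclideanreal (\<lambda>x. g x i)"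
    and nz: "\<And>x. x \<in> topspace X \<Longrightarrow> \<exists>i\<le>p. g x i \<noteq> 0"
  shows "continuous_map X (nsphere p) (normalise p g)"
proof -
  have pos: "0 < L2_set (g x) {..p}" if "x \<in> topspace X" for x
    using nz[OF that] L2_set_atMost_pos by blast
  have L2: "continuous_map X euclideanreal (\<lambda>x. L2_set (g x) {..p})"
    unfolding L2_set_def
    by (intro continuous_map_sqrt continuous_map_sum continuous_map_real_pow g) auto
  have cont: "continuous_map X euclideanreal (\<lambda>x. g x i / L2_set (g x) {..p})" if "i < Suc p" for i
    using pos that by (intro continuous_map_real_divide g L2) fastforce+
  have "continuous_map X (Euclidean_space (Suc p)) (normalise p g)"
    using cont unfolding normalise_def[abs_def] less_Suc_eq_le[symmetric]
    by (subst continuous_map_componentwise_Euclidean_space) auto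
  moreover have "(\<Sum>i\<le>p. (normalise p g x i)\<^sup>2) = 1" if "x \<in> topspace X" for x
  proof -
    have "(\<Sum>i\<le>p. (normalise p g x i)\<^sup>2) = (\<Sum>i\<le>p. (g x i)\<^sup>2) / (L2_set (g x) {..p})\<^sup>2"
      by (simp add: normalise_def power_divide sum_divide_distrib)
    also have "(\<Sum>i\<le>p. (g x i)\<^sup>2) = (L2_set (g x) {..p})\<^sup>2"
      by (simp add: L2_set_def sum_nonneg)
    finally show ?thesis
      using pos[OF that] by simp
  qed
  ultimately show ?thesis
    by (auto simp: nsphere_def continuous_map_in_subtopology)
qed

lemma continuous_map_normalise:
  "admissible p g \<Longrightarrow> continuous_map (nsphere p) (nsphere p) (normalise p g)"
  by (rule continuous_map_normalise_gen) (auto simp: admissible_def)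

text \<open>The straight-line homotopy avoids the origin, so it can be normalised to a homotopy of
  sphere maps.\<close>

lemma degree_of_homotopic:
  assumes f: "admissible p f" and g: "admissible p g"
    and nz: "\<And>x s. \<lbrakk>x \<in> topspace (nsphere p); 0 \<le> s; s \<le> 1\<rbrakk> \<Longrightarrow> \<exists>i\<le>p. (1 - s) * f x i + s * g x i \<noteq> 0"
  shows "degree_of p f = degree_of p g"
proof -
  define h where "h z = normalise p (\<lambda>z i. (1 - fst z) * f (snd z) i + fst z * g (snd z) i) z" for z :: "real \<times> (nat \<Rightarrow> real)"
  let ?X = "prod_topology (subtopology euclideanreal {0..1}) (nsphere p)"
  have c: "continuous_map ?X euclideanreal (\<lambda>z. q (snd z) i)" if "admissible p q" "i \<le> p"
    for q :: "(nat \<Rightarrow> real) \<Rightarrow> nat \<Rightarrow> real" and i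
    using continuous_map_compose[OF continuous_map_snd admissibleD(1)[OF that]] by (simp add: o_def)
  have "continuous_map ?X (subtopology euclideanreal {0..1}) fst"
    by (rule continuous_map_fst)
  then have t: "continuous_map ?X euclideanreal fst"
    by (rule continuous_map_into_fulltopology)
  have "continuous_map ?X (nsphere p) h"
    unfolding h_def[abs_def]
  proof (rule continuous_map_normalise_gen)
    show "\<exists>i\<le>p. (1 - fst z) * f (snd z) i + fst z * g (snd z) i \<noteq> 0" if "z \<in> topspace ?X" for z
      using that nz by auto
    show "continuous_map ?X euclideanreal (\<lambda>z. (1 - fst z) * f (snd z) i + fst z * g (snd z) i)" if "i \<le> p" for i
      by (intro continuous_map_add continuous_map_real_mult continuous_map_diff c[OF f that] c[OF g that] t) auto
  qed
  moreover have "h (0, x) = normalise p f x" "h (1, x) = normalise p g x" for x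
    unfolding h_def normalise_def by (simp_all only: fst_conv snd_conv diff_zero mult_1_left mult_zero_left
        add_0_left add_0_right diff_self)
  ultimately have "homotopic_with (\<lambda>_. True) (nsphere p) (nsphere p) (normalise p f) (normalise p g)"
    unfolding homotopic_with_def by (intro exI[of _ h] conjI allI ballI TrueI)
  then show ?thesis
    unfolding degree_of_def by (rule Brouwer_degree2_homotopic)
qed

text \<open>The normalised map omits the point \<open>y\<close>, and a map of the sphere that is not
  surjective has degree 0.\<close>

lemma degree_of_missing_direction:
  assumes f: "admissible p f" and y: "y \<in> topspace (nsphere p)"
    and miss: "\<And>x c. \<lbrakk>x \<in> topspace (nsphere p); 0 < c\<rbrakk> \<Longrightarrow> \<exists>i\<le>p. f x i \<noteq> c * y i"
  shows "degree_of p f = 0"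
proof -
  have "normalise p f x \<noteq> y" if x: "x \<in> topspace (nsphere p)" for x
  proof
    assume "normalise p f x = y"
    then have "\<forall>i\<le>p. f x i / L2_set (f x) {..p} = y i"
      by (auto simp: normalise_def)
    then have "\<forall>i\<le>p. f x i = L2_set (f x) {..p} * y i"
      using admissibleD(2)[OF f x] by (auto simp: field_simps)
    then show False
      using miss[OF x admissibleD(2)[OF f x]] by blast
  qed
  then have "y \<notin> normalise p f ` topspace (nsphere p)"
    by (metis imageE)
  then have "normalise p f ` topspace (nsphere p) \<noteq> topspace (nsphere p)"
    using y by metis
  then show ?thesis
    unfolding degree_of_def by (intro Brouwer_degree2_nonsurjective continuous_map_normalise f)
qed

lemma degree_of_local:
  assumes adm: "admissible p f1" "admissible p g1" "admissible p f2" "admissible p g2"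
    and opn: "openin (nsphere p) U" "openin (nsphere p) W" "topspace (nsphere p) \<subseteq> U \<union> W"
    and U: "\<And>x i. \<lbrakk>x \<in> U; i \<le> p\<rbrakk> \<Longrightarrow> f1 x i = f2 x i" "\<And>x i. \<lbrakk>x \<in> U; i \<le> p\<rbrakk> \<Longrightarrow> g1 x i = g2 x i"
    and W: "\<And>x i. \<lbrakk>x \<in> W; i \<le> p\<rbrakk> \<Longrightarrow> f1 x i = g1 x i" "\<And>x i. \<lbrakk>x \<in> W; i \<le> p\<rbrakk> \<Longrightarrow> f2 x i = g2 x i"
  shows "degree_of p f1 - degree_of p g1 = degree_of p f2 - degree_of p g2"
proof -
  have eq: "normalise p f x = normalise p g x" if "\<And>i. i \<le> p \<Longrightarrow> f x i = g x i" for f g x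
    using that L2_set_cong[of "{..p}" "{..p}" "f x" "g x"] by (auto simp: normalise_def fun_eq_iff)
  show ?thesis
    unfolding degree_of_def
    by (rule Brouwer_degree2_local[of p _ _ _ _ U W])
      (use adm opn U W in \<open>auto intro!: continuous_map_normalise eq\<close>)
qed

lemma degree_of_id: "degree_of p (\<lambda>x. x) = 1"
proof -
  have "normalise p (\<lambda>x. x) x = id x" if "x \<in> topspace (nsphere p)" for x
    using that by (auto simp: in_nsphere_iff normalise_def L2_set_def fun_eq_iff)
  then have "Brouwer_degree2 p (normalise p (\<lambda>x. x)) = Brouwer_degree2 p id"
    by (rule Brouwer_degree2_eq)
  then show ?thesis
    by (simp add: degree_of_def)
qed

lemma degree_of_reflection: "degree_of p (\<lambda>x i. if i = 0 then - x i else x i) = - 1"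
proof -
  have "normalise p (\<lambda>x i. if i = 0 then - x i else x i) x = (\<lambda>i. if i = 0 then - x i else x i)"
    if "x \<in> topspace (nsphere p)" for x
  proof -
    have "(\<Sum>i\<le>p. (if i = 0 then - x i else x i)\<^sup>2) = (\<Sum>i\<le>p. (x i)\<^sup>2)"
      by (intro sum.cong) auto
    then show ?thesis
      using that by (auto simp: in_nsphere_iff normalise_def L2_set_def fun_eq_iff)
  qed
  then have "Brouwer_degree2 p (normalise p (\<lambda>x i. if i = 0 then - x i else x i))
      = Brouwer_degree2 p (\<lambda>x i. if i = 0 then - x i else x i)"
    by (rule Brouwer_degree2_eq)
  then show ?thesis
    by (simp add: degree_of_def Brouwer_degree2_reflection)
qed

subsection \<open>Degree of an invertible linear map\<close>

text \<open>The matrix-vector product on the function representation of points that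
  \<open>nsphere\<close> uses.\<close>

definition act :: "nat \<Rightarrow> real mat \<Rightarrow> (nat \<Rightarrow> real) \<Rightarrow> nat \<Rightarrow> real"
  where "act p M x i = (\<Sum>j\<le>p. M $$ (i, j) * x j)"

lemma degree_of_cong:
  assumes "\<And>x i. \<lbrakk>x \<in> topspace (nsphere p); i \<le> p\<rbrakk> \<Longrightarrow> f x i = g x i"
  shows "degree_of p f = degree_of p g"
  unfolding degree_of_def
proof (rule Brouwer_degree2_eq)
  fix x :: "nat \<Rightarrow> real" assume "x \<in> topspace (nsphere p)"
  then show "normalise p f x = normalise p g x"
    using assms[of x] L2_set_cong[of "{..p}" "{..p}" "f x" "g x"] by (auto simp: normalise_def fun_eq_iff)
qed

lemma nsphere_nonzero:
  assumes "x \<in> topspace (nsphere p)"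
  obtains i where "i \<le> p" "x i \<noteq> 0"
proof -
  have "(\<Sum>i\<le>p. (x i)\<^sup>2) \<noteq> 0"
    using assms by (simp add: in_nsphere_iff)
  then show ?thesis
    using that by (metis (no_types, lifting) atMost_iff sum.neutral zero_power2)
qed

lemma act_index:
  assumes "M \<in> carrier_mat (Suc p) (Suc p)" "i \<le> p"
  shows "act p M x i = (M *\<^sub>v vec (Suc p) x) $ i"
  using assms by (auto simp: act_def scalar_prod_def lessThan_Suc_atMost[symmetric] lessThan_atLeast0 intro!: sum.cong)

lemma act_nonzero:
  assumes M: "M \<in> carrier_mat (Suc p) (Suc p)" and d: "det M \<noteq> 0" and x: "i0 \<le> p" "x i0 \<noteq> 0"
  shows "\<exists>i\<le>p. act p M x i \<noteq> 0"
proof (rule ccontr)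
  assume neg: "\<not> ?thesis"
  have "M *\<^sub>v vec (Suc p) x = 0\<^sub>v (Suc p)"
  proof (rule eq_vecI)
    fix i assume "i < dim_vec (0\<^sub>v (Suc p) :: real vec)"
    then have "i \<le> p"
      by simp
    then show "(M *\<^sub>v vec (Suc p) x) $ i = 0\<^sub>v (Suc p) $ i"
      using neg act_index[OF M, of i x] by auto
  qed (use M in auto)
  moreover have "vec (Suc p) x \<noteq> 0\<^sub>v (Suc p)"
    using x by (metis index_vec index_zero_vec(1) less_Suc_eq_le)
  ultimately show False
    using d det_0_iff_vec_prod_zero[OF M] vec_carrier by blast
qed

lemma admissible_act:
  assumes "M \<in> carrier_mat (Suc p) (Suc p)" "det M \<noteq> 0"
  shows "admissible p (act p M)"
  unfolding admissible_def
proof (intro conjI allI impI ballI)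
  show "continuous_map (nsphere p) euclideanreal (\<lambda>x. act p M x i)" for i
    unfolding act_def
    by (intro continuous_map_sum continuous_map_real_mult_left continuous_map_nsphere_projection) auto
  show "\<exists>i\<le>p. act p M x i \<noteq> 0" if "x \<in> topspace (nsphere p)" for x
    using nsphere_nonzero[OF that] act_nonzero[OF assms] by metis
qed

text \<open>The hypothesis keeps the segment from \<open>M\<close> to \<open>N\<close> inside the
  invertible matrices, so the straight-line homotopy of the linear maps has no zero on the
  sphere.\<close>

lemma degree_of_act_homotopic:
  assumes M: "M \<in> carrier_mat (Suc p) (Suc p)" and N: "N \<in> carrier_mat (Suc p) (Suc p)"
    and det: "\<And>s. \<lbrakk>0 \<le> s; s \<le> 1\<rbrakk> \<Longrightarrow>
      det (mat (Suc p) (Suc p) (\<lambda>(i, j). (1 - s) * M $$ (i, j) + s * N $$ (i, j))) \<noteq> 0"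
  shows "degree_of p (act p M) = degree_of p (act p N)"
proof (rule degree_of_homotopic)
  let ?P = "\<lambda>s. mat (Suc p) (Suc p) (\<lambda>(i, j). (1 - s) * M $$ (i, j) + s * N $$ (i, j))"
  have "?P 0 = M" "?P 1 = N"
    using M N by (auto intro!: eq_matI)
  then have "det M \<noteq> 0" "det N \<noteq> 0"
    using det[of 0] det[of 1] by auto
  then show "admissible p (act p M)" "admissible p (act p N)"
    using M N by (auto intro: admissible_act)
  fix x s
  assume x: "x \<in> topspace (nsphere p)" and s: "0 \<le> (s::real)" "s \<le> 1"
  obtain i0 where "i0 \<le> p" "x i0 \<noteq> 0"
    using nsphere_nonzero[OF x] by blast
  then obtain i where i: "i \<le> p" "act p (?P s) x i \<noteq> 0"
    using act_nonzero[of "?P s" p i0 x] det[OF s] by auto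
  have "act p (?P s) x i = (1 - s) * act p M x i + s * act p N x i"
    using i(1) by (simp add: act_def sum_distrib_left flip: sum.distrib)
      (intro sum.cong, auto simp: algebra_simps)
  then show "\<exists>i\<le>p. (1 - s) * act p M x i + s * act p N x i \<noteq> 0"
    using i by auto
qed

section \<open>Elimination by row additions, which preserve determinant and degree\<close>

lemma degree_of_act_addrow:
  assumes M: "M \<in> carrier_mat (Suc p) (Suc p)" and d: "det M \<noteq> 0" and kl: "k \<noteq> l" "l < Suc p"
  shows "degree_of p (act p (addrow a k l M)) = degree_of p (act p M)"
proof (rule degree_of_act_homotopic[symmetric])
  fix s :: real
  \<comment> \<open>The segment consists of row additions with coefficient \<open>s * a\<close>, so
    the determinant is constant along it.\<close>
  have "mat (Suc p) (Suc p) (\<lambda>(i, j). (1 - s) * M $$ (i, j) + s * addrow a k l M $$ (i, j)) = addrow (s * a) k l M"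
    using M kl by (intro eq_matI) (auto simp: algebra_simps)
  then show "det (mat (Suc p) (Suc p) (\<lambda>(i, j). (1 - s) * M $$ (i, j) + s * addrow a k l M $$ (i, j))) \<noteq> 0"
    using det_addrow[OF kl(2,1) M, of "s * a"] d by simp
qed (use M in auto)

definition addrow_step :: "nat \<Rightarrow> real mat \<Rightarrow> real mat \<Rightarrow> bool"
  where "addrow_step n M N \<longleftrightarrow> (\<exists>a k l. k < n \<and> l < n \<and> k \<noteq> l \<and> N = addrow a k l M)"

lemma addrow_steps_invariant:
  assumes "(addrow_step (Suc p))\<^sup>*\<^sup>* M N" "M \<in> carrier_mat (Suc p) (Suc p)" "det M \<noteq> 0"
  shows "N \<in> carrier_mat (Suc p) (Suc p) \<and> det N = det M \<and> degree_of p (act p N) = degree_of p (act p M)"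
  using assms(1)
proof (induction rule: rtranclp_induct)
  case (step N N')
  then show ?case
    using assms det_addrow[of _ "Suc p" _ N] degree_of_act_addrow[of N p] by (auto simp: addrow_step_def)
qed (use assms in auto)

text \<open>Row \<open>k\<close> stays fixed throughout, since \<open>k\<close> is not in
  \<open>I\<close>; hence the result is expressed by the entries of the original
  \<open>M\<close>.\<close>

lemma addrow_steps_clear:
  assumes M: "M \<in> carrier_mat n n" and k: "k < n" and I: "finite I" "I \<subseteq> {..<n} - {k}"
  shows "\<exists>N. (addrow_step n)\<^sup>*\<^sup>* M N \<and> N \<in> carrier_mat n n \<and>
    (\<forall>i<n. \<forall>j<n. N $$ (i, j) = (if i \<in> I then M $$ (i, j) - c i * M $$ (k, j) else M $$ (i, j)))"
  using I
proof (induction I rule: finite_induct)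
  case empty
  then show ?case
    using M by auto
next
  case (insert r I)
  then obtain N where N: "(addrow_step n)\<^sup>*\<^sup>* M N" "N \<in> carrier_mat n n"
    "\<forall>i<n. \<forall>j<n. N $$ (i, j) = (if i \<in> I then M $$ (i, j) - c i * M $$ (k, j) else M $$ (i, j))"
    by auto
  have r: "r < n" "r \<noteq> k" and "k \<notin> I"
    using insert.prems by auto
  then have "addrow_step n N (addrow (- c r) r k N)"
    using k by (auto simp: addrow_step_def)
  then show ?case
    using N r \<open>k \<notin> I\<close> k insert.hyps(2)
    by (intro exI[of _ "addrow (- c r) r k N"]) (auto intro: rtranclp.rtrancl_into_rtrancl)
qed

text \<open>Supplies pivots. If column \<open>k\<close> vanished in rows up to \<open>k\<close>, it
  would be a combination of the unit columns to its right.\<close>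

lemma nonzero_entry_above:
  fixes M :: "real mat"
  assumes M: "M \<in> carrier_mat n n" and d: "det M \<noteq> 0" and k: "k < n"
    and unit: "\<And>i j. \<lbrakk>i < n; k < j; j < n\<rbrakk> \<Longrightarrow> M $$ (i, j) = (if i = j then 1 else 0)"
  shows "\<exists>i\<le>k. M $$ (i, k) \<noteq> 0"
proof (rule ccontr)
  assume neg: "\<not> ?thesis"
  \<comment> \<open>The coefficients of that linear dependence, hence a kernel vector with entry 1
    at \<open>k\<close>.\<close>
  define v where "v = vec n (\<lambda>j. if j = k then 1 else if k < j then - M $$ (j, k) else 0)"
  have "M *\<^sub>v v = 0\<^sub>v n"
  proof (rule eq_vecI)
    fix i assume "i < dim_vec (0\<^sub>v n :: real vec)"
    then have i: "i < n"
      by simp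
    have "(M *\<^sub>v v) $ i = (\<Sum>j<n. M $$ (i, j) * v $ j)"
      using M i by (auto simp: scalar_prod_def v_def lessThan_atLeast0 intro!: sum.cong)
    also have "\<dots> = (\<Sum>j<n. (if j = k then M $$ (i, k) else 0) + (if j = i then (if k < i then - M $$ (i, k) else 0) else 0))"
      using unit[OF i] by (intro sum.cong) (auto simp: v_def)
    also have "\<dots> = M $$ (i, k) + (if k < i then - M $$ (i, k) else 0)"
      using k i by (simp add: sum.distrib)
    also have "\<dots> = 0"
      using neg by auto
    finally show "(M *\<^sub>v v) $ i = 0\<^sub>v n $ i"
      using i by simp
  qed (use M in auto)
  moreover have "v $ k \<noteq> 0\<^sub>v n $ k"
    using k by (simp add: v_def)
  moreover have "v \<in> carrier_vec n"
    by (simp add: v_def)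
  ultimately show False
    using d det_0_iff_vec_prod_zero[OF M] by metis
qed

text \<open>Columns are turned into unit columns from right to left. Row additions alone can make a
  diagonal entry equal to 1 if there is a nonzero entry above it, which is why column 0 is never
  treated: \<open>m\<close> stops at \<open>p\<close>.\<close>

lemma addrow_steps_unit_columns:
  assumes M: "M \<in> carrier_mat (Suc p) (Suc p)" and d: "det M \<noteq> 0"
  shows "m \<le> p \<Longrightarrow> \<exists>N. (addrow_step (Suc p))\<^sup>*\<^sup>* M N \<and>
    (\<forall>i j. i \<le> p \<longrightarrow> p - m < j \<longrightarrow> j \<le> p \<longrightarrow> N $$ (i, j) = (if i = j then 1 else 0))"
proof (induction m)
  case 0
  then show ?case
    by auto
next
  case (Suc m)
  define k where "k = p - m"
  have k: "0 < k" "k \<le> p"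
    using Suc.prems by (auto simp: k_def)
  obtain N where N: "(addrow_step (Suc p))\<^sup>*\<^sup>* M N"
    and unit: "\<And>i j. \<lbrakk>i \<le> p; k < j; j \<le> p\<rbrakk> \<Longrightarrow> N $$ (i, j) = (if i = j then 1 else 0)"
    using Suc by (auto simp: k_def)
  have Nc: "N \<in> carrier_mat (Suc p) (Suc p)" and Nd: "det N \<noteq> 0"
    using addrow_steps_invariant[OF N M d] d by auto
  obtain i0 where i0: "i0 \<le> k" "N $$ (i0, k) \<noteq> 0"
    using nonzero_entry_above[OF Nc Nd, of k] k unit by auto
  \<comment> \<open>A pivot strictly above the diagonal is wanted. If only the diagonal entry is
    nonzero, row \<open>k\<close> is added to row 0; the columns beyond \<open>k\<close> survive, as
    row \<open>k\<close> vanishes there.\<close>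
  have "\<exists>N1 i. (addrow_step (Suc p))\<^sup>*\<^sup>* N N1 \<and> N1 \<in> carrier_mat (Suc p) (Suc p) \<and> i < k \<and> N1 $$ (i, k) \<noteq> 0 \<and>
      (\<forall>i j. i \<le> p \<longrightarrow> k < j \<longrightarrow> j \<le> p \<longrightarrow> N1 $$ (i, j) = (if i = j then 1 else 0))"
  proof (cases "\<exists>i<k. N $$ (i, k) \<noteq> 0")
    case True
    then show ?thesis
      using Nc unit by blast
  next
    case False
    then have "i0 = k" and "N $$ (0, k) = 0"
      using i0 k le_neq_implies_less by blast+
    moreover have "addrow_step (Suc p) N (addrow 1 0 k N)"
      using k unfolding addrow_step_def by (intro exI[of _ 1] exI[of _ 0] exI[of _ k]) auto
    ultimately show ?thesis
      using Nc unit k i0 by (intro exI[of _ "addrow 1 0 k N"] exI[of _ 0]) auto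
  qed
  then obtain N1 i where N1: "(addrow_step (Suc p))\<^sup>*\<^sup>* N N1" "N1 \<in> carrier_mat (Suc p) (Suc p)"
    and i: "i < k" "N1 $$ (i, k) \<noteq> 0"
    and unit1: "\<And>i j. \<lbrakk>i \<le> p; k < j; j \<le> p\<rbrakk> \<Longrightarrow> N1 $$ (i, j) = (if i = j then 1 else 0)"
    by blast
  \<comment> \<open>The coefficient is the one that turns the entry at \<open>(k, k)\<close> into
    1.\<close>
  define N2 where "N2 = addrow ((1 - N1 $$ (k, k)) / N1 $$ (i, k)) k i N1"
  have "addrow_step (Suc p) N1 N2"
    using i k unfolding addrow_step_def N2_def
    by (intro exI[of _ "(1 - N1 $$ (k, k)) / N1 $$ (i, k)"] exI[of _ k] exI[of _ i]) auto
  then have N2: "(addrow_step (Suc p))\<^sup>*\<^sup>* N1 N2" "N2 \<in> carrier_mat (Suc p) (Suc p)"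
    using N1 by (auto simp: N2_def)
  have kk: "N2 $$ (k, k) = 1"
    using i k N1 by (simp add: N2_def)
  have unit2: "N2 $$ (r, j) = (if r = j then 1 else 0)" if "r \<le> p" "k < j" "j \<le> p" for r j
    using i k N1 unit1[OF _ that(2,3)] that by (auto simp: N2_def)
  \<comment> \<open>Clears the rest of column \<open>k\<close>; row \<open>k\<close> of
    \<open>N2\<close> is zero to the right of \<open>k\<close>, so the finished columns do not
    change.\<close>
  obtain N3 where N3: "(addrow_step (Suc p))\<^sup>*\<^sup>* N2 N3"
    "\<forall>i<Suc p. \<forall>j<Suc p. N3 $$ (i, j) =
      (if i \<in> {..<Suc p} - {k} then N2 $$ (i, j) - N2 $$ (i, k) * N2 $$ (k, j) else N2 $$ (i, j))"
    using addrow_steps_clear[OF N2(2), of k "{..<Suc p} - {k}" "\<lambda>i. N2 $$ (i, k)"] k by auto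
  have "N3 $$ (r, j) = (if r = j then 1 else 0)" if "r \<le> p" "p - Suc m < j" "j \<le> p" for r j
  proof (cases "j = k")
    case True
    then show ?thesis
      using N3(2) kk that by auto
  next
    case False
    then have "k < j"
      using that by (auto simp: k_def)
    then show ?thesis
      using N3(2) unit2[of _ j] that k by auto
  qed
  moreover have "(addrow_step (Suc p))\<^sup>*\<^sup>* M N3"
    using N N1(1) N2(1) N3(1) by (meson rtranclp_trans)
  ultimately show ?case
    by blast
qed

text \<open>After elimination only column 0 can differ from a unit column, so the matrix is lower
  triangular with diagonal \<open>det M, 1, ..., 1\<close>. It is then deformed to the identity or
  to a reflection.\<close>

theorem degree_of_act:
  assumes M: "M \<in> carrier_mat (Suc p) (Suc p)" and d: "det M \<noteq> 0"
  shows "real_of_int (degree_of p (act p M)) = sgn (det M)"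
proof -
  obtain N where N: "(addrow_step (Suc p))\<^sup>*\<^sup>* M N"
    and unit: "\<And>i j. \<lbrakk>i \<le> p; 0 < j; j \<le> p\<rbrakk> \<Longrightarrow> N $$ (i, j) = (if i = j then 1 else 0)"
    using addrow_steps_unit_columns[OF M d, of p] by auto
  have Nc: "N \<in> carrier_mat (Suc p) (Suc p)" and Nd: "det N = det M"
    and deg: "degree_of p (act p N) = degree_of p (act p M)"
    using addrow_steps_invariant[OF N M d] by auto
  have det_tri: "det T = T $$ (0, 0)" if T: "T \<in> carrier_mat (Suc p) (Suc p)"
    and u: "\<And>i j. \<lbrakk>i \<le> p; 0 < j; j \<le> p\<rbrakk> \<Longrightarrow> T $$ (i, j) = (if i = j then 1 else 0)" for T :: "real mat"
  proof -
    have "det T = prod_list (diag_mat T)"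
      using u T by (intro det_lower_triangular[of "Suc p"]) auto
    also have "\<dots> = (\<Prod>i<Suc p. T $$ (i, i))"
      using T by (simp add: diag_mat_def prod.list_conv_set_nth lessThan_atLeast0 del: prod.op_ivl_Suc upt_Suc)
    also have "\<dots> = T $$ (0, 0)"
      using u by (simp add: prod.lessThan_Suc_shift del: prod.lessThan_Suc)
    finally show ?thesis .
  qed
  have N00: "N $$ (0, 0) = det M"
    using det_tri[OF Nc unit] Nd by auto
  \<comment> \<open>Along the segment from \<open>N\<close> to \<open>D\<close> the columns after
    the first stay unit columns. The determinant is thus the corner entry, which moves from
    \<open>det M\<close> to its sign without meeting 0.\<close>
  define D where "D = mat (Suc p) (Suc p) (\<lambda>(i, j). if i = j then (if i = 0 then sgn (det M) else 1) else 0 :: real)"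
  have "degree_of p (act p N) = degree_of p (act p D)"
  proof (rule degree_of_act_homotopic)
    fix s :: real
    assume s: "0 \<le> s" "s \<le> 1"
    let ?P = "mat (Suc p) (Suc p) (\<lambda>(i, j). (1 - s) * N $$ (i, j) + s * D $$ (i, j))"
    have "det ?P = ?P $$ (0, 0)"
      by (rule det_tri) (auto simp: D_def unit)
    also have "\<dots> = (1 - s) * det M + s * sgn (det M)"
      using N00 by (simp add: D_def)
    also have "\<dots> = sgn (det M) * ((1 - s) * \<bar>det M\<bar> + s)"
      by (simp add: sgn_real_def algebra_simps)
    also have "\<dots> \<noteq> 0"
    proof -
      have "0 < (1 - s) * \<bar>det M\<bar> + s"
        using s d by (cases "s = 1") (auto intro!: add_pos_nonneg)
      then show ?thesis
        using d by (simp add: sgn_real_def)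
    qed
    finally show "det ?P \<noteq> 0" .
  qed (auto simp: Nc D_def)
  also have "\<dots> = degree_of p (\<lambda>x i. if i = 0 then sgn (det M) * x i else x i)"
  proof (rule degree_of_cong)
    fix x :: "nat \<Rightarrow> real" and i assume i: "i \<le> p"
    have "act p D x i = (\<Sum>j\<le>p. if j = i then (if i = 0 then sgn (det M) * x i else x i) else 0)"
      unfolding act_def using i by (intro sum.cong) (auto simp: D_def)
    then show "act p D x i = (if i = 0 then sgn (det M) * x i else x i)"
      using i by simp
  qed
  also have "real_of_int \<dots> = sgn (det M)"
  proof (cases "det M > 0")
    case True
    have "degree_of p (\<lambda>x i. if i = 0 then sgn (det M) * x i else x i) = degree_of p (\<lambda>x. x)"
      using True by (intro degree_of_cong) auto
    then show ?thesis
      using True by (simp add: degree_of_id)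
  next
    case False
    then have "sgn (det M) = - 1"
      using d by auto
    then have "degree_of p (\<lambda>x i. if i = 0 then sgn (det M) * x i else x i)
        = degree_of p (\<lambda>x i. if i = 0 then - x i else x i)"
      by (intro degree_of_cong) auto
    then show ?thesis
      using \<open>sgn (det M) = - 1\<close> by (simp add: degree_of_reflection)
  qed
  finally show ?thesis
    using deg by simp
qed

subsection \<open>Simple eigenvalues and linear pencils\<close>

lemma real_det_pencil:
  fixes B :: "real mat"
  assumes B: "B \<in> carrier_mat n n" and t: "t \<noteq> 0"
  shows "det (1\<^sub>m n - t \<cdot>\<^sub>m B) = t ^ n * poly (char_poly B) (1 / t)"
proof -
  have "1\<^sub>m n - t \<cdot>\<^sub>m B = t \<cdot>\<^sub>m (- char_matrix B (1 / t))"
    using B t by (intro eq_matI) (auto simp: char_matrix_def algebra_simps)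
  moreover have "- char_matrix B (1 / t) \<in> carrier_mat n n"
    using B by (auto simp: char_matrix_def)
  ultimately show ?thesis
    by (simp add: char_poly_matrix[OF B])
qed

lemma act_pencil:
  assumes "B \<in> carrier_mat (Suc p) (Suc p)" "i \<le> p"
  shows "act p (1\<^sub>m (Suc p) - t \<cdot>\<^sub>m B) x i = x i - t * act p B x i"
proof -
  have "act p (1\<^sub>m (Suc p) - t \<cdot>\<^sub>m B) x i = (\<Sum>j\<le>p. (if j = i then x i else 0) - t * (B $$ (i, j) * x j))"
    unfolding act_def using assms by (intro sum.cong) (auto simp: algebra_simps)
  then show ?thesis
    using assms by (simp add: sum_subtractf sum_distrib_left act_def)
qed

lemma pencil_kernel:
  assumes B: "B \<in> carrier_mat (Suc p) (Suc p)" and d: "det (1\<^sub>m (Suc p) - t \<cdot>\<^sub>m B) \<noteq> 0"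
    and z: "\<And>i. i \<le> p \<Longrightarrow> x i = t * act p B x i" and i: "i \<le> p"
  shows "x i = 0"
proof (rule ccontr)
  assume "x i \<noteq> 0"
  moreover have "1\<^sub>m (Suc p) - t \<cdot>\<^sub>m B \<in> carrier_mat (Suc p) (Suc p)"
    using B by auto
  ultimately obtain k where "k \<le> p" "act p (1\<^sub>m (Suc p) - t \<cdot>\<^sub>m B) x k \<noteq> 0"
    using act_nonzero d i by blast
  then show False
    using z[of k] act_pencil[OF B] by simp
qed

text \<open>
  If \<open>B x = \<mu> x\<close> and \<open>(\<mu> - B) y = c x\<close>, then \<open>(T - B) ((T - \<mu>) y - c x) = (T - \<mu>)\<^sup>2 y\<close>; multiplying by
  the adjugate shows that \<open>(T - \<mu>)\<^sup>2\<close> divides \<open>\<chi>\<^sub>B ((T - \<mu>) y - c x)\<close>, where the second factor does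
  not vanish at \<open>\<mu>\<close> unless \<open>c = 0\<close>.
\<close>

lemma simple_eigenvalue_not_in_range:
  assumes B: "B \<in> carrier_mat (Suc p) (Suc p)" and simple: "simple_eigenvalue B \<mu>"
    and x: "\<And>i. i \<le> p \<Longrightarrow> act p B x i = \<mu> * x i" "k \<le> p" "x k \<noteq> 0"
    and y: "\<And>i. i \<le> p \<Longrightarrow> \<mu> * y i - act p B y i = c * x i"
  shows "c = 0"
proof (rule ccontr)
  assume c: "c \<noteq> 0"
  define P where "P = char_poly_matrix B"
  define W where "W j = [:- \<mu>, 1:] * [:y j:] - [:c * x j:]" for j
  have Pc: "P \<in> carrier_mat (Suc p) (Suc p)"
    using B by (simp add: P_def)
  have P: "P $$ (i, j) = (if i = j then [:0, 1:] else 0) - [:B $$ (i, j):]" if "i \<le> p" "j \<le> p" for i j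
    using that B by (auto simp: P_def char_poly_matrix_def)
  have PW: "(\<Sum>j\<le>p. P $$ (i, j) * W j) = [:- \<mu>, 1:]\<^sup>2 * [:y i:]" if i: "i \<le> p" for i
  proof -
    have "poly (\<Sum>j\<le>p. P $$ (i, j) * W j) s = poly ([:- \<mu>, 1:]\<^sup>2 * [:y i:]) s" for s
    proof -
      have "poly (\<Sum>j\<le>p. P $$ (i, j) * W j) s
          = (\<Sum>j\<le>p. (if j = i then s * ((s - \<mu>) * y i - c * x i) else 0)
              - (s - \<mu>) * (B $$ (i, j) * y j) + c * (B $$ (i, j) * x j))"
        unfolding poly_sum using i by (intro sum.cong) (auto simp: P W_def algebra_simps)
      also have "\<dots> = s * ((s - \<mu>) * y i - c * x i) - (s - \<mu>) * act p B y i + c * act p B x i"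
        using i by (simp add: sum.distrib sum_subtractf sum_distrib_left act_def)
      also have "act p B y i = \<mu> * y i - c * x i"
        using y[OF i] by simp
      finally show ?thesis
        by (simp add: x(1)[OF i] power2_eq_square algebra_simps)
    qed
    then show ?thesis
      by (simp add: poly_eq_poly_eq_iff[symmetric] fun_eq_iff)
  qed
  have adj: "(\<Sum>i\<le>p. adj_mat P $$ (k, i) * P $$ (i, j)) = (if k = j then char_poly B else 0)"
    if j: "j \<le> p" for j
  proof -
    have "(\<Sum>i\<le>p. adj_mat P $$ (k, i) * P $$ (i, j)) = (adj_mat P * P) $$ (k, j)"
      using Pc adj_mat(1)[OF Pc] j x(2)
      by (auto simp: scalar_prod_def lessThan_Suc_atMost[symmetric] lessThan_atLeast0 intro!: sum.cong)
    also have "\<dots> = (det P \<cdot>\<^sub>m 1\<^sub>m (Suc p)) $$ (k, j)"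
      by (simp add: adj_mat(3)[OF Pc])
    finally show ?thesis
      using j x(2) by (simp add: P_def char_poly_def)
  qed
  have "char_poly B * W k = (\<Sum>j\<le>p. (if k = j then char_poly B else 0) * W j)"
    using x(2) by (simp add: if_distrib[of "\<lambda>z. z * _"] cong: if_cong)
  also have "\<dots> = (\<Sum>j\<le>p. (\<Sum>i\<le>p. adj_mat P $$ (k, i) * P $$ (i, j)) * W j)"
    by (intro sum.cong) (auto simp: adj)
  also have "\<dots> = (\<Sum>i\<le>p. adj_mat P $$ (k, i) * (\<Sum>j\<le>p. P $$ (i, j) * W j))"
    unfolding sum_distrib_right sum_distrib_left by (subst sum.swap) (simp add: mult.assoc)
  also have "\<dots> = (\<Sum>i\<le>p. adj_mat P $$ (k, i) * ([:- \<mu>, 1:]\<^sup>2 * [:y i:]))"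
    by (intro sum.cong) (auto simp: PW)
  also have "\<dots> = [:- \<mu>, 1:]\<^sup>2 * (\<Sum>i\<le>p. adj_mat P $$ (k, i) * [:y i:])"
    by (simp only: sum_distrib_left mult.left_commute)
  finally have "[:- \<mu>, 1:]\<^sup>2 dvd char_poly B * W k"
    by (rule dvdI)
  moreover have Wk: "poly (W k) \<mu> \<noteq> 0"
    using c x(3) by (simp add: W_def)
  moreover have nz: "char_poly B * W k \<noteq> 0"
    using Wk degree_monic_char_poly[OF B] by auto
  \<comment> \<open>The factor \<open>W k\<close> does not vanish at \<open>\<mu>\<close>, so the
    double root would have to come from the characteristic polynomial.\<close>
  ultimately have "2 \<le> order \<mu> (char_poly B * W k)"
    using order_max by blast
  also have "\<dots> = 1"
    using nz simple order_0I[OF Wk] by (simp add: order_mult simple_eigenvalue_def)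
  finally show False
    by simp
qed

text \<open>Write \<open>q\<close> as \<open>[:- \<mu>, 1:] * r\<close>; then \<open>r\<close> takes
  the nonzero value of the derivative at \<open>\<mu>\<close> and keeps its sign nearby.\<close>

lemma simple_root_sign_change:
  fixes q :: "real poly"
  assumes "order \<mu> q = 1" "q \<noteq> 0"
  obtains \<delta> where "0 < \<delta>" "\<And>s. \<bar>s - \<mu>\<bar> < \<delta> \<Longrightarrow> sgn (poly q s) = sgn (s - \<mu>) * sgn (poly (pderiv q) \<mu>)"
    "poly (pderiv q) \<mu> \<noteq> 0"
proof -
  obtain r where r: "q = [:- \<mu>, 1:] * r" "\<not> [:- \<mu>, 1:] dvd r"
    using order_decomp[OF assms(2), of \<mu>] assms(1) by auto
  have r0: "poly r \<mu> \<noteq> 0"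
    using r(2) by (simp add: poly_eq_0_iff_dvd)
  have deriv: "poly (pderiv q) \<mu> = poly r \<mu>"
    unfolding r(1) pderiv_mult by (simp add: pderiv_pCons)
  have "isCont (poly r) \<mu>"
    by simp
  then obtain \<delta> where \<delta>: "0 < \<delta>" "\<And>s. \<bar>s - \<mu>\<bar> < \<delta> \<Longrightarrow> \<bar>poly r s - poly r \<mu>\<bar> < \<bar>poly r \<mu>\<bar>"
    using r0 unfolding continuous_at_eps_delta dist_real_def by (metis zero_less_abs_iff)
  have "sgn (poly q s) = sgn (s - \<mu>) * sgn (poly (pderiv q) \<mu>)" if s: "\<bar>s - \<mu>\<bar> < \<delta>" for s
  proof -
    have "sgn (poly r s) = sgn (poly r \<mu>)"
      using \<delta>(2)[OF s] by (auto simp: sgn_real_def abs_real_def split: if_splits)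
    moreover have "poly q s = (s - \<mu>) * poly r s"
      by (simp add: r(1) algebra_simps)
    ultimately show ?thesis
      by (simp add: sgn_mult deriv)
  qed
  then show ?thesis
    using that \<delta>(1) r0 deriv by auto
qed

text \<open>Up to the positive factor \<open>t ^ n\<close> the determinant is the characteristic
  polynomial at \<open>1 / t\<close>. At \<open>t1\<close> this argument lies to the right of
  \<open>\<mu>\<close>, where the sign is that of the derivative.\<close>

lemma pencil_sign_change:
  fixes B :: "real mat"
  assumes B: "B \<in> carrier_mat n n" and simple: "simple_eigenvalue B \<mu>" and \<mu>: "1 < \<mu>"
  obtains t1 t2 where "0 < t1" "t1 < 1 / \<mu>" "1 / \<mu> < t2" "t2 \<le> 1"
    "\<And>t. \<lbrakk>t1 \<le> t; t \<le> t2; t \<noteq> 1 / \<mu>\<rbrakk> \<Longrightarrow> det (1\<^sub>m n - t \<cdot>\<^sub>m B) \<noteq> 0"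
    "sgn (det (1\<^sub>m n - t1 \<cdot>\<^sub>m B)) = sgn (poly (pderiv (char_poly B)) \<mu>)"
proof -
  obtain \<delta> where \<delta>: "0 < \<delta>"
      "\<And>s. \<bar>s - \<mu>\<bar> < \<delta> \<Longrightarrow> sgn (poly (char_poly B) s) = sgn (s - \<mu>) * sgn (poly (pderiv (char_poly B)) \<mu>)"
      "poly (pderiv (char_poly B)) \<mu> \<noteq> 0"
    using simple_root_sign_change simple degree_monic_char_poly[OF B] unfolding simple_eigenvalue_def
    by (metis leading_coeff_0_iff zero_neq_one)
  \<comment> \<open>The bound \<open>\<mu> - 1\<close> ensures
    \<open>t2 = 1 / (\<mu> - \<epsilon>) \<le> 1\<close>.\<close>
  define \<epsilon> where "\<epsilon> = min (\<delta> / 2) (\<mu> - 1)"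
  have \<epsilon>: "0 < \<epsilon>" "\<epsilon> < \<delta>" "1 \<le> \<mu> - \<epsilon>"
    using \<delta>(1) \<mu> by (auto simp: \<epsilon>_def)
  have sgn_det: "sgn (det (1\<^sub>m n - t \<cdot>\<^sub>m B)) = sgn (1 / t - \<mu>) * sgn (poly (pderiv (char_poly B)) \<mu>)"
    if t: "1 / (\<mu> + \<epsilon>) \<le> t" "t \<le> 1 / (\<mu> - \<epsilon>)" for t
  proof -
    have "0 < 1 / (\<mu> + \<epsilon>)"
      using \<epsilon> \<mu> by simp
    then have t0: "0 < t"
      using t(1) by linarith
    have "1 / t \<le> \<mu> + \<epsilon>" "\<mu> - \<epsilon> \<le> 1 / t"
      using t t0 \<epsilon> \<mu> by (auto simp: field_simps)
    then have "\<bar>1 / t - \<mu>\<bar> < \<delta>"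
      using \<epsilon> by linarith
    then show ?thesis
      using \<delta>(2) t0 by (simp add: real_det_pencil[OF B] sgn_mult)
  qed
  show ?thesis
  proof (rule that[of "1 / (\<mu> + \<epsilon>)" "1 / (\<mu> - \<epsilon>)"])
    show "det (1\<^sub>m n - t \<cdot>\<^sub>m B) \<noteq> 0" if "1 / (\<mu> + \<epsilon>) \<le> t" "t \<le> 1 / (\<mu> - \<epsilon>)" "t \<noteq> 1 / \<mu>" for t
    proof -
      have "1 / t \<noteq> \<mu>"
        using that(3) by auto
      then have "sgn (det (1\<^sub>m n - t \<cdot>\<^sub>m B)) \<noteq> 0"
        unfolding sgn_det[OF that(1,2)] using \<delta>(3) by (simp add: sgn_zero_iff)
      then show ?thesis
        by auto
    qed
    have "1 / (\<mu> + \<epsilon>) \<le> 1 / (\<mu> - \<epsilon>)"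
      using \<epsilon> by (intro divide_left_mono) auto
    from sgn_det[OF order_refl this]
    show "sgn (det (1\<^sub>m n - (1 / (\<mu> + \<epsilon>)) \<cdot>\<^sub>m B)) = sgn (poly (pderiv (char_poly B)) \<mu>)"
      using \<epsilon> by simp
  qed (use \<epsilon> \<mu> in \<open>auto simp: field_simps\<close>)
qed

text \<open>
  The model map for crossing one critical value: \<open>\<sigma>\<close> exceeds \<open>1 / \<mu>\<close> at the eigenvector \<open>x0\<close> but not at
  \<open>- x0\<close>, so both poles are mapped to the negative multiples of \<open>x0\<close>.
\<close>

lemma degree_of_pencil_one_pole:
  assumes B: "B \<in> carrier_mat (Suc p) (Suc p)" and simple: "simple_eigenvalue B \<mu>" and \<mu>: "0 < \<mu>"
    and x0: "x0 \<in> topspace (nsphere p)" "\<And>i. i \<le> p \<Longrightarrow> act p B x0 i = \<mu> * x0 i"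
    and det: "\<And>x. \<lbrakk>x \<in> topspace (nsphere p); \<sigma> x \<noteq> 1 / \<mu>\<rbrakk> \<Longrightarrow> det (1\<^sub>m (Suc p) - \<sigma> x \<cdot>\<^sub>m B) \<noteq> 0"
    and poles: "1 / \<mu> < \<sigma> x0" "\<sigma> (\<lambda>i. - x0 i) < 1 / \<mu>"
    and adm: "admissible p (\<lambda>x i. x i - \<sigma> x * act p B x i)"
  shows "degree_of p (\<lambda>x i. x i - \<sigma> x * act p B x i) = 0"
proof (rule degree_of_missing_direction[OF adm x0(1)], rule ccontr)
  fix x c
  assume x: "x \<in> topspace (nsphere p)" and c: "0 < (c::real)"
    and "\<not> (\<exists>i\<le>p. x i - \<sigma> x * act p B x i \<noteq> c * x0 i)"
  then have eq: "x i - \<sigma> x * act p B x i = c * x0 i" if "i \<le> p" for i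
    using that by blast
  obtain k where k: "k \<le> p" "x0 k \<noteq> 0"
    using nsphere_nonzero[OF x0(1)] .
  show False
  proof (cases "\<sigma> x = 1 / \<mu>")
    case True
    \<comment> \<open>A nonzero multiple of the eigenvector would lie in the range of
      \<open>\<mu> - B\<close>, contrary to simplicity.\<close>
    have "\<mu> * x i - act p B x i = \<mu> * c * x0 i" if "i \<le> p" for i
      using eq[OF that] True \<mu> by (simp add: field_simps)
    then have "\<mu> * c = 0"
      using simple_eigenvalue_not_in_range[OF B simple x0(2) k] by blast
    then show False
      using c \<mu> by simp
  next
    case False
    \<comment> \<open>Chosen so that \<open>r * x0\<close> is also mapped to \<open>c * x0\<close>
      by the linear map with parameter \<open>\<sigma> x\<close>. Invertibility then forces
      \<open>x = r * x0\<close>, hence \<open>r\<close> is 1 or -1, and at either pole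
      \<open>c\<close> comes out negative.\<close>
    define r where "r = c / (1 - \<sigma> x * \<mu>)"
    have ne: "1 - \<sigma> x * \<mu> \<noteq> 0"
      using False \<mu> by (auto simp: field_simps)
    then have c_eq: "c = r * (1 - \<sigma> x * \<mu>)"
      by (simp add: r_def)
    have act_lin: "act p B (\<lambda>i. x i - r * x0 i) i = act p B x i - r * act p B x0 i" for i
      by (simp add: act_def sum_subtractf sum_distrib_left algebra_simps)
    have "x i - r * x0 i = \<sigma> x * act p B (\<lambda>i. x i - r * x0 i) i" if "i \<le> p" for i
      using eq[OF that] x0(2)[OF that] by (simp add: act_lin c_eq algebra_simps)
    from pencil_kernel[OF B det[OF x False], of "\<lambda>i. x i - r * x0 i", OF this]
    have xr: "x i = r * x0 i" if "i \<le> p" for i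
      using that by simp
    have "(\<Sum>i\<le>p. (x i)\<^sup>2) = r\<^sup>2 * (\<Sum>i\<le>p. (x0 i)\<^sup>2)"
      by (simp add: xr power_mult_distrib sum_distrib_left)
    then have "r\<^sup>2 = 1"
      using x x0(1) by (simp add: in_nsphere_iff)
    then consider "r = 1" | "r = - 1"
      by (auto simp: power2_eq_1_iff)
    then show False
    proof cases
      case 1
      then have "x = x0"
        using x x0(1) xr by (intro ext) (metis in_nsphere_iff linorder_not_le mult_1)
      then show False
        using c c_eq 1 poles(1) \<mu> by (simp add: field_simps)
    next
      case 2
      have "x i = - x0 i" for i
        using x x0(1) xr[of i] 2 by (cases "i \<le> p") (auto simp: in_nsphere_iff)
      then have "x = (\<lambda>i. - x0 i)"
        by auto
      then show False
        using c c_eq 2 poles(2) \<mu> by (simp add: field_simps)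
    qed
  qed
qed

subsection \<open>Expanding pairs of generic matrices\<close>

lemma sign_matsD:
  assumes "S \<in> sign_mats n"
  shows "S \<in> carrier_mat n n"
    and "\<lbrakk>i < n; j < n; i \<noteq> j\<rbrakk> \<Longrightarrow> S $$ (i, j) = 0"
    and "i < n \<Longrightarrow> S $$ (i, i) = 1 \<or> S $$ (i, i) = - 1"
  using assms by (auto simp: sign_mats_def diagonal_mat_def)

lemma sign_mats_square: "\<lbrakk>S \<in> sign_mats n; i < n\<rbrakk> \<Longrightarrow> S $$ (i, i) * (S $$ (i, i) * z) = z"
  using sign_matsD(3) by fastforce

lemma sign_mult_index:
  assumes S: "S \<in> sign_mats n" and A: "A \<in> carrier_mat n n" and ij: "i < n" "j < n"
  shows "(S * A) $$ (i, j) = S $$ (i, i) * A $$ (i, j)" "(A * S) $$ (i, j) = A $$ (i, j) * S $$ (j, j)"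
proof -
  note Sc = sign_matsD(1)[OF S]
  have "(S * A) $$ (i, j) = (\<Sum>k<n. S $$ (i, k) * A $$ (k, j))"
    using Sc A ij by (auto simp: scalar_prod_def lessThan_atLeast0 intro!: sum.cong)
  also have "\<dots> = (\<Sum>k<n. if k = i then S $$ (i, i) * A $$ (i, j) else 0)"
    using sign_matsD(2)[OF S] ij by (intro sum.cong) auto
  finally show "(S * A) $$ (i, j) = S $$ (i, i) * A $$ (i, j)"
    using ij by simp
  have "(A * S) $$ (i, j) = (\<Sum>k<n. A $$ (i, k) * S $$ (k, j))"
    using Sc A ij by (auto simp: scalar_prod_def lessThan_atLeast0 intro!: sum.cong)
  also have "\<dots> = (\<Sum>k<n. if k = j then A $$ (i, j) * S $$ (j, j) else 0)"
    using sign_matsD(2)[OF S] ij by (intro sum.cong) auto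
  finally show "(A * S) $$ (i, j) = A $$ (i, j) * S $$ (j, j)"
    using ij by simp
qed

text \<open>Conjugation by the involution \<open>S\<close>. The pairs are stated for
  \<open>S * A\<close>, whereas on the orthant of \<open>S\<close> the map involves
  \<open>A * S\<close>.\<close>

lemma char_poly_sign_commute:
  assumes S: "S \<in> sign_mats n" and A: "A \<in> carrier_mat n n"
  shows "char_poly (S * A) = char_poly (A * S)"
proof (rule char_poly_similar, rule similar_matI)
  note Sc = sign_matsD(1)[OF S]
  show SS: "S * S = 1\<^sub>m n"
    using Sc sign_mats_square[OF S, of _ 1]
    by (intro eq_matI) (auto simp: sign_mult_index[OF S Sc] sign_matsD(2)[OF S] simp del: index_mult_mat(1))
  then show "S * S = 1\<^sub>m n" .
  have "S * (A * S) * S = S * A * (S * S)"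
    using Sc A by (simp add: assoc_mult_mat[of _ n n _ n _ n])
  then show "S * A = S * (A * S) * S"
    using Sc A SS by simp
  show "{S * A, A * S, S, S} \<subseteq> carrier_mat n n"
    using Sc A by auto
qed

lemma act_mult_sign:
  assumes "S \<in> sign_mats (Suc p)" "A \<in> carrier_mat (Suc p) (Suc p)" "i \<le> p"
  shows "act p (A * S) x i = act p A (\<lambda>j. S $$ (j, j) * x j) i"
    and "act p (S * A) x i = S $$ (i, i) * act p A x i"
  using assms by (auto simp: act_def sign_mult_index sum_distrib_left mult.assoc)

lemma act_scale: "act p M (\<lambda>j. c * x j) i = c * act p M x i"
  by (simp add: act_def sum_distrib_left algebra_simps)

lemma act_diff: "act p M (\<lambda>j. x j - y j) i = act p M x i - act p M y i"
  by (simp add: act_def sum_subtractf algebra_simps)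

lemma act_cong: "(\<And>j. j \<le> p \<Longrightarrow> x j = y j) \<Longrightarrow> act p M x i = act p M y i"
  by (simp add: act_def)

lemma sign_eigen_iff:
  assumes S: "S \<in> sign_mats (Suc p)" and A: "A \<in> carrier_mat (Suc p) (Suc p)"
  shows "(S * A) *\<^sub>v vec (Suc p) u = \<mu> \<cdot>\<^sub>v vec (Suc p) u \<longleftrightarrow>
    (\<forall>i\<le>p. S $$ (i, i) * act p A u i = \<mu> * u i)"
proof -
  have SA: "S * A \<in> carrier_mat (Suc p) (Suc p)"
    using sign_matsD(1)[OF S] A by auto
  have "(S * A) *\<^sub>v vec (Suc p) u = \<mu> \<cdot>\<^sub>v vec (Suc p) u \<longleftrightarrow>
      (\<forall>i\<le>p. ((S * A) *\<^sub>v vec (Suc p) u) $ i = (\<mu> \<cdot>\<^sub>v vec (Suc p) u) $ i)"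
    using SA by (auto simp: vec_eq_iff less_Suc_eq_le simp del: index_mult_mat_vec)
  also have "\<dots> \<longleftrightarrow> (\<forall>i\<le>p. S $$ (i, i) * act p A u i = \<mu> * u i)"
    using S A by (auto simp: act_index[OF SA, symmetric] act_mult_sign(2) simp del: index_mult_mat_vec)
  finally show ?thesis .
qed

text \<open>Scaled to norm 1, \<open>u\<close> becomes part of an aligned trio, to which genericity
  applies.\<close>

lemma generic_eigenvector:
  assumes A: "A \<in> carrier_mat (Suc p) (Suc p)" and gen: "generic A"
    and S: "S \<in> sign_mats (Suc p)" and \<mu>: "0 \<le> \<mu>"
    and u: "\<And>i. i \<le> p \<Longrightarrow> 0 \<le> u i" "k \<le> p" "u k \<noteq> 0"
    and eig: "\<And>i. i \<le> p \<Longrightarrow> S $$ (i, i) * act p A u i = \<mu> * u i"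
  shows "\<mu> \<in> aligned_spectrum A" "simple_eigenvalue (S * A) \<mu>" "i \<le> p \<Longrightarrow> 0 < u i"
proof -
  define N where "N = L2_set u {..p}"
  have N: "0 < N"
    using L2_set_atMost_pos u by (auto simp: N_def)
  let ?v = "vec (Suc p) (\<lambda>i. (1 / N) * u i)"
  have "norm2 ?v = L2_set (\<lambda>i. (1 / N) * u i) {..p}"
    unfolding norm2_def by (intro L2_set_cong) auto
  also have "\<dots> = (1 / N) * L2_set u {..p}"
    using N by (subst L2_set_right_distrib) auto
  also have "\<dots> = 1"
    using N by (simp add: N_def)
  finally have "norm2 ?v = 1" .
  moreover have "(S * A) *\<^sub>v ?v = \<mu> \<cdot>\<^sub>v ?v"
    unfolding sign_eigen_iff[OF S A] act_scale using eig by (simp add: algebra_simps)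
  moreover have "?v \<in> nonneg_vecs (Suc p)"
    using u(1) N by (auto simp: nonneg_vecs_def)
  ultimately have trio: "aligned_trio A \<mu> S ?v"
    unfolding aligned_trio_def using A S \<mu> by auto
  then show "\<mu> \<in> aligned_spectrum A"
    unfolding aligned_spectrum_def by blast
  have *: "simple_eigenvalue (S * A) \<mu>" "?v \<in> pos_vecs (Suc p)"
    using trio gen A unfolding generic_def by auto
  then show "simple_eigenvalue (S * A) \<mu>"
    by simp
  show "0 < u i" if "i \<le> p"
    using *(2) that N by (auto simp: pos_vecs_def less_Suc_eq_le zero_less_divide_iff)
qed

text \<open>
  Two independent nonnegative eigenvectors would span a line leaving the orthant through a boundary
  point, which contradicts positivity.
\<close>

lemma generic_eigenvector_unique:
  assumes A: "A \<in> carrier_mat (Suc p) (Suc p)" and gen: "generic A"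
    and S: "S \<in> sign_mats (Suc p)" and \<mu>: "0 \<le> \<mu>"
    and u: "\<And>i. i \<le> p \<Longrightarrow> 0 < u i" "\<And>i. i \<le> p \<Longrightarrow> S $$ (i, i) * act p A u i = \<mu> * u i"
    and w: "\<And>i. i \<le> p \<Longrightarrow> 0 < w i" "\<And>i. i \<le> p \<Longrightarrow> S $$ (i, i) * act p A w i = \<mu> * w i"
  obtains c where "0 < c" "\<And>i. i \<le> p \<Longrightarrow> u i = c * w i"
proof -
  \<comment> \<open>The largest \<open>c\<close> for which \<open>u - c * w\<close> is still
    nonnegative; a coordinate where the minimum is attained becomes 0.\<close>
  define c where "c = Min ((\<lambda>i. u i / w i) ` {..p})"
  have "c \<in> (\<lambda>i. u i / w i) ` {..p}"
    unfolding c_def by (intro Min_in) auto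
  then obtain k where k: "k \<le> p" "c = u k / w k"
    by auto
  have c_le: "c \<le> u i / w i" if "i \<le> p" for i
    unfolding c_def using that by (intro Min_le) auto
  have c: "0 < c"
    using k u(1) w(1) by simp
  define z where "z i = u i - c * w i" for i
  have z_nonneg: "0 \<le> z i" if "i \<le> p" for i
    using c_le[OF that] w(1)[OF that] by (simp add: z_def field_simps)
  have z_eig: "S $$ (i, i) * act p A z i = \<mu> * z i" if "i \<le> p" for i
    unfolding z_def[abs_def] act_diff act_scale using u(2)[OF that] w(2)[OF that] by (simp add: algebra_simps)
  have "z k = 0"
    using k w(1)[OF k(1)] by (simp add: z_def)
  then have "z i = 0" if "i \<le> p" for i
    using generic_eigenvector(3)[OF A gen S \<mu>, of z i k] z_nonneg z_eig that k(1) by fastforce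
  then show ?thesis
    using that c by (auto simp: z_def)
qed

text \<open>The zero of \<open>x \<mapsto> x - (1 / \<mu>) A \<bar>x\<bar>\<close> on the sphere belonging to an expanding pair \<open>(\<mu>, S)\<close>.\<close>

definition critical_point :: "nat \<Rightarrow> real mat \<Rightarrow> real \<times> real mat \<Rightarrow> (nat \<Rightarrow> real) \<Rightarrow> bool"
  where "critical_point p A e x \<longleftrightarrow> x \<in> topspace (nsphere p) \<and>
    (\<forall>i\<le>p. 0 < snd e $$ (i, i) * x i) \<and> (\<forall>i\<le>p. act p A (\<lambda>j. \<bar>x j\<bar>) i = fst e * x i)"

lemma critical_point_abs:
  assumes "critical_point p A e x" "snd e \<in> sign_mats (Suc p)" "i \<le> p"
  shows "\<bar>x i\<bar> = snd e $$ (i, i) * x i"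
proof -
  have "0 < snd e $$ (i, i) * x i"
    using assms by (auto simp: critical_point_def)
  then show ?thesis
    using sign_matsD(3)[OF assms(2), of i] assms(3) by auto
qed

lemma expanding_pairsD:
  assumes A: "A \<in> carrier_mat (Suc p) (Suc p)" and gen: "generic A" and e: "e \<in> expanding_pairs A"
  shows "1 < fst e" "snd e \<in> sign_mats (Suc p)" "simple_eigenvalue (snd e * A) (fst e)"
    "\<exists>x. critical_point p A e x"
proof -
  obtain \<mu> S v where eq: "e = (\<mu>, S)" and \<mu>: "1 < \<mu>" and S: "S \<in> sign_mats (Suc p)"
    and v: "v \<in> pos_vecs (Suc p)" "(S * A) *\<^sub>v v = \<mu> \<cdot>\<^sub>v v"
    using e A by (auto simp: expanding_pairs_def)
  show "1 < fst e" "snd e \<in> sign_mats (Suc p)"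
    using eq \<mu> S by auto
  define u where "u i = v $ i" for i
  have vec: "v = vec (Suc p) u"
    using v(1) by (auto simp: pos_vecs_def u_def)
  have pos: "0 < u i" if "i \<le> p" for i
    using v(1) that by (auto simp: pos_vecs_def u_def)
  have eig: "S $$ (i, i) * act p A u i = \<mu> * u i" if "i \<le> p" for i
    using v(2) that unfolding vec sign_eigen_iff[OF S A] by blast
  show "simple_eigenvalue (snd e * A) (fst e)"
    using generic_eigenvector(2)[OF A gen S, of \<mu> u 0] \<mu> pos eig eq by (simp add: less_imp_le less_le)
  define N where "N = L2_set u {..p}"
  have N: "0 < N"
    unfolding N_def using pos[of 0] by (intro L2_set_atMost_pos[of 0]) auto
  \<comment> \<open>The point \<open>S u\<close>, normalised: its absolute value is
    \<open>u / N\<close>, and applying \<open>A\<close> gives \<open>\<mu> * x\<close> because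
    \<open>S\<close> is an involution.\<close>
  define x where "x i = (if i \<le> p then S $$ (i, i) * u i / N else 0)" for i
  have sq: "(S $$ (i, i))\<^sup>2 = 1" and abs_S: "\<bar>S $$ (i, i)\<bar> = 1" if "i \<le> p" for i
    using sign_matsD(3)[OF S, of i] that by auto
  have "critical_point p A (\<mu>, S) x"
    unfolding critical_point_def
  proof (intro conjI allI impI)
    have "(\<Sum>i\<le>p. (x i)\<^sup>2) = (\<Sum>i\<le>p. (u i)\<^sup>2) / N\<^sup>2"
      by (simp add: x_def power_divide power_mult_distrib sq sum_divide_distrib)
    also have "\<dots> = 1"
      using N by (simp add: N_def L2_set_def sum_nonneg)
    finally show "x \<in> topspace (nsphere p)"
      by (auto simp: in_nsphere_iff x_def)
  next
    fix i assume i: "i \<le> p"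
    show "0 < snd (\<mu>, S) $$ (i, i) * x i"
      using i N pos[OF i] S by (simp add: x_def sign_mats_square)
    have "act p A (\<lambda>j. \<bar>x j\<bar>) i = act p A (\<lambda>j. (1 / N) * u j) i"
      using N pos by (intro act_cong) (auto simp: x_def abs_mult abs_S less_imp_le)
    also have "\<dots> = (1 / N) * (S $$ (i, i) * (S $$ (i, i) * act p A u i))"
      unfolding act_scale using i S by (simp add: sign_mats_square)
    also have "\<dots> = fst (\<mu>, S) * x i"
      using i by (simp add: eig x_def)
    finally show "act p A (\<lambda>j. \<bar>x j\<bar>) i = fst (\<mu>, S) * x i" .
  qed
  then show "\<exists>x. critical_point p A e x"
    using eq by blast
qed

text \<open>The absolute values of \<open>x\<close> and \<open>y\<close> are positive eigenvectors
  of the same matrix, hence proportional; the signs agree by \<open>S\<close>, and the norms fix the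
  factor.\<close>

lemma critical_point_unique:
  assumes A: "A \<in> carrier_mat (Suc p) (Suc p)" and gen: "generic A"
    and S: "snd e \<in> sign_mats (Suc p)" and \<mu>: "0 \<le> fst e"
    and x: "critical_point p A e x" and y: "critical_point p A e y"
  shows "x = y"
proof -
  have pos: "0 < \<bar>z i\<bar>" and eig: "snd e $$ (i, i) * act p A (\<lambda>j. \<bar>z j\<bar>) i = fst e * \<bar>z i\<bar>"
    if "critical_point p A e z" "i \<le> p" for z i
    using that critical_point_abs[OF that(1) S that(2)] by (auto simp: critical_point_def)
  obtain c where c: "0 < c" "\<And>i. i \<le> p \<Longrightarrow> \<bar>x i\<bar> = c * \<bar>y i\<bar>"
    using generic_eigenvector_unique[OF A gen S \<mu>, of "\<lambda>j. \<bar>x j\<bar>" "\<lambda>j. \<bar>y j\<bar>"] pos[OF x] pos[OF y] eig[OF x] eig[OF y]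
    by blast
  have xy: "x i = c * y i" if "i \<le> p" for i
  proof -
    have "snd e $$ (i, i) * x i = c * (snd e $$ (i, i) * y i)"
      using c(2)[OF that] critical_point_abs[OF x S that] critical_point_abs[OF y S that] by simp
    then have "snd e $$ (i, i) * (snd e $$ (i, i) * x i) = c * (snd e $$ (i, i) * (snd e $$ (i, i) * y i))"
      by (simp add: algebra_simps)
    then show ?thesis
      using that by (simp add: sign_mats_square[OF S])
  qed
  have "(\<Sum>i\<le>p. (x i)\<^sup>2) = c\<^sup>2 * (\<Sum>i\<le>p. (y i)\<^sup>2)"
    by (simp add: xy power_mult_distrib sum_distrib_left)
  then have "c = 1"
    using x y c(1) by (auto simp: critical_point_def in_nsphere_iff power2_eq_1_iff)
  then show ?thesis
    using x y xy by (intro ext) (metis critical_point_def in_nsphere_iff linorder_not_le mult_1)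
qed

text \<open>The signs of \<open>x\<close> determine the sign matrix, and one coordinate of the
  eigenvalue equation determines the eigenvalue.\<close>

lemma critical_point_inj:
  assumes S: "snd e \<in> sign_mats (Suc p)" and S': "snd e' \<in> sign_mats (Suc p)"
    and x: "critical_point p A e x" "critical_point p A e' x"
  shows "e = e'"
proof -
  have x0: "x i \<noteq> 0" if "i \<le> p" for i
    using x(1) that by (auto simp: critical_point_def)
  have "fst e * x 0 = fst e' * x 0"
    using x by (metis critical_point_def le0)
  then have "fst e = fst e'"
    using x0 by simp
  moreover have "snd e = snd e'"
  proof (rule eq_matI)
    fix i j assume "i < dim_row (snd e')" "j < dim_col (snd e')"
    then have ij: "i \<le> p" "j \<le> p"
      using sign_matsD(1)[OF S'] by auto
    have "snd e $$ (i, i) * x i = snd e' $$ (i, i) * x i"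
      using critical_point_abs[OF x(1) S ij(1)] critical_point_abs[OF x(2) S' ij(1)] by linarith
    then show "snd e $$ (i, j) = snd e' $$ (i, j)"
      using x0 ij sign_matsD(2)[OF S] sign_matsD(2)[OF S'] by (cases "i = j") auto
  qed (use sign_matsD(1)[OF S] sign_matsD(1)[OF S'] in auto)
  ultimately show ?thesis
    by (rule prod_eqI)
qed

text \<open>With \<open>S\<close> the sign matrix of \<open>x\<close>, the zero says that the
  absolute value of \<open>x\<close> is an eigenvector of \<open>S * A\<close> for
  \<open>1 / t\<close>.\<close>

lemma zero_imp_critical_point:
  assumes A: "A \<in> carrier_mat (Suc p) (Suc p)" and gen: "generic A" and spec: "1 \<notin> aligned_spectrum A"
    and x: "x \<in> topspace (nsphere p)" and t: "0 \<le> t" "t \<le> 1"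
    and zero: "\<And>i. i \<le> p \<Longrightarrow> x i = t * act p A (\<lambda>j. \<bar>x j\<bar>) i"
  shows "\<exists>e \<in> expanding_pairs A. critical_point p A e x \<and> t = 1 / fst e"
proof -
  obtain k where k: "k \<le> p" "x k \<noteq> 0"
    using nsphere_nonzero[OF x] .
  then have "t \<noteq> 0"
    using zero[of k] by auto
  then have t0: "0 < t"
    using t by simp
  \<comment> \<open>Zero coordinates get the sign 1 for the moment; genericity later shows that
    there are none.\<close>
  define S where "S = mat (Suc p) (Suc p) (\<lambda>(i, j). if i = j then (if 0 \<le> x i then 1 else - 1) else 0 :: real)"
  have S: "S \<in> sign_mats (Suc p)"
    by (auto simp: S_def sign_mats_def diagonal_mat_def)
  have Sx: "S $$ (i, i) * x i = \<bar>x i\<bar>" if "i \<le> p" for i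
    using that by (simp add: S_def)
  have act: "act p A (\<lambda>j. \<bar>x j\<bar>) i = (1 / t) * x i" if "i \<le> p" for i
    using zero[OF that] t0 by (simp add: field_simps)
  have eig: "S $$ (i, i) * act p A (\<lambda>j. \<bar>x j\<bar>) i = (1 / t) * \<bar>x i\<bar>" if "i \<le> p" for i
    using act[OF that] Sx[OF that] by (metis mult.left_commute)
  note gen_x = generic_eigenvector[OF A gen S, of "1 / t" "\<lambda>j. \<bar>x j\<bar>" k]
  have spec_t: "1 / t \<in> aligned_spectrum A" and pos: "\<And>i. i \<le> p \<Longrightarrow> 0 < \<bar>x i\<bar>"
    using gen_x(1) gen_x(3) k t0 eig by auto
  \<comment> \<open>The hypothesis on the aligned spectrum enters here and makes the pair strictly
    expanding.\<close>
  have "1 / t \<noteq> 1"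
    using spec_t spec by metis
  then have t1: "1 < 1 / t"
    using t t0 by (auto simp: field_simps)
  have "(S * A) *\<^sub>v vec (Suc p) (\<lambda>j. \<bar>x j\<bar>) = (1 / t) \<cdot>\<^sub>v vec (Suc p) (\<lambda>j. \<bar>x j\<bar>)"
    unfolding sign_eigen_iff[OF S A] using eig by blast
  moreover have "vec (Suc p) (\<lambda>j. \<bar>x j\<bar>) \<in> pos_vecs (Suc p)"
    using pos by (auto simp: pos_vecs_def less_Suc_eq_le)
  ultimately have "(1 / t, S) \<in> expanding_pairs A"
    unfolding expanding_pairs_def using t1 S A by auto
  moreover have "critical_point p A (1 / t, S) x"
    unfolding critical_point_def using x Sx pos act by simp
  ultimately show ?thesis
    by force
qed

subsection \<open>Crossing the critical values\<close>

text \<open>The parameter depends on the point, so one pair can be crossed separately even when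
  several share the same eigenvalue.\<close>

definition abs_pencil :: "nat \<Rightarrow> real mat \<Rightarrow> ((nat \<Rightarrow> real) \<Rightarrow> real) \<Rightarrow> (nat \<Rightarrow> real) \<Rightarrow> nat \<Rightarrow> real"
  where "abs_pencil p A \<tau> x i = x i - \<tau> x * act p A (\<lambda>j. \<bar>x j\<bar>) i"

lemma continuous_map_pencil:
  assumes "continuous_map (nsphere p) euclideanreal \<tau>"
  shows "continuous_map (nsphere p) euclideanreal (\<lambda>x. x i - \<tau> x * act p A (\<lambda>j. \<bar>x j\<bar>) i)"
    and "continuous_map (nsphere p) euclideanreal (\<lambda>x. x i - \<tau> x * act p A x i)"
  unfolding act_def
  by (intro continuous_map_diff continuous_map_real_mult assms continuous_map_sum continuous_map_real_mult_left
      continuous_map_real_abs continuous_map_nsphere_projection; simp)+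

locale generic_matrix =
  fixes p :: nat and A :: "real mat"
  assumes A: "A \<in> carrier_mat (Suc p) (Suc p)" and gen: "generic A" and spec: "1 \<notin> aligned_spectrum A"
begin

text \<open>\<open>J\<close> is the set of expanding pairs whose critical value \<open>1 / \<mu>\<close> has been passed by \<open>\<tau>\<close>.\<close>

definition crossing :: "((nat \<Rightarrow> real) \<Rightarrow> real) \<Rightarrow> (real \<times> real mat) set \<Rightarrow> bool"
  where "crossing \<tau> J \<longleftrightarrow> continuous_map (nsphere p) euclideanreal \<tau> \<and>
    (\<forall>x \<in> topspace (nsphere p). 0 \<le> \<tau> x \<and> \<tau> x \<le> 1) \<and>
    (\<forall>e \<in> expanding_pairs A. \<forall>x. critical_point p A e x \<longrightarrow>
      \<tau> x \<noteq> 1 / fst e \<and> (1 / fst e < \<tau> x \<longleftrightarrow> e \<in> J))"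

lemma crossing_nonzero:
  assumes \<tau>: "crossing \<tau> J" and x: "x \<in> topspace (nsphere p)"
  shows "\<exists>i\<le>p. abs_pencil p A \<tau> x i \<noteq> 0"
proof (rule ccontr)
  assume "\<not> ?thesis"
  then have "x i = \<tau> x * act p A (\<lambda>j. \<bar>x j\<bar>) i" if "i \<le> p" for i
    using that by (simp add: abs_pencil_def)
  then obtain e where "e \<in> expanding_pairs A" "critical_point p A e x" "\<tau> x = 1 / fst e"
    using zero_imp_critical_point[OF A gen spec x, of "\<tau> x"] \<tau> x unfolding crossing_def by blast
  then show False
    using \<tau> unfolding crossing_def by blast
qed

lemma admissible_crossing: "crossing \<tau> J \<Longrightarrow> admissible p (abs_pencil p A \<tau>)"
  using crossing_nonzero unfolding admissible_def
  by (auto simp: abs_pencil_def crossing_def intro!: continuous_map_pencil)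

text \<open>The functions crossing exactly \<open>J\<close> form a convex set and
  \<open>abs_pencil\<close> is affine in \<open>\<tau>\<close>, so the straight-line homotopy stays
  inside the family without zeros.\<close>

lemma degree_of_crossing_cong:
  assumes \<tau>: "crossing \<tau> J" and \<upsilon>: "crossing \<upsilon> J"
  shows "degree_of p (abs_pencil p A \<tau>) = degree_of p (abs_pencil p A \<upsilon>)"
proof (rule degree_of_homotopic)
  fix x s
  assume x: "x \<in> topspace (nsphere p)" and s: "0 \<le> (s::real)" "s \<le> 1"
  let ?\<rho> = "\<lambda>x. (1 - s) * \<tau> x + s * \<upsilon> x"
  have "crossing ?\<rho> J"
    unfolding crossing_def
  proof (intro conjI ballI allI impI)
    show "continuous_map (nsphere p) euclideanreal ?\<rho>"
      using \<tau> \<upsilon> unfolding crossing_def by (intro continuous_map_add continuous_map_real_mult_left) auto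
    show "0 \<le> ?\<rho> x" if "x \<in> topspace (nsphere p)" for x
      using that \<tau> \<upsilon> s by (simp add: crossing_def)
    show "?\<rho> x \<le> 1" if "x \<in> topspace (nsphere p)" for x
      using that \<tau> \<upsilon> s by (intro convex_bound_le) (auto simp: crossing_def)
    fix e x assume e: "e \<in> expanding_pairs A" and x: "critical_point p A e x"
    have "(if e \<in> J then 1 / fst e < ?\<rho> x else ?\<rho> x < 1 / fst e)"
    proof (cases "e \<in> J")
      case True
      then have "1 / fst e < \<tau> x" "1 / fst e < \<upsilon> x"
        using \<tau> \<upsilon> e x unfolding crossing_def by blast+
      then have "- ?\<rho> x < - (1 / fst e)"
        using s convex_bound_lt[of "- \<tau> x" "- (1 / fst e)" "- \<upsilon> x" "1 - s" s] by simp
      then show ?thesis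
        using True by simp
    next
      case False
      then have "\<tau> x < 1 / fst e" "\<upsilon> x < 1 / fst e"
        using \<tau> \<upsilon> e x unfolding crossing_def by (metis linorder_neqE_linordered_idom)+
      then have "?\<rho> x < 1 / fst e"
        using s by (intro convex_bound_lt) auto
      then show ?thesis
        using False by simp
    qed
    then show "?\<rho> x \<noteq> 1 / fst e" "1 / fst e < ?\<rho> x \<longleftrightarrow> e \<in> J"
      by (auto split: if_splits)
  qed
  then obtain i where "i \<le> p" "abs_pencil p A ?\<rho> x i \<noteq> 0"
    using crossing_nonzero x by blast
  moreover have "abs_pencil p A ?\<rho> x i = (1 - s) * abs_pencil p A \<tau> x i + s * abs_pencil p A \<upsilon> x i"
    by (simp add: abs_pencil_def algebra_simps)
  ultimately show "\<exists>i\<le>p. (1 - s) * abs_pencil p A \<tau> x i + s * abs_pencil p A \<upsilon> x i \<noteq> 0"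
    by auto
qed (use \<tau> \<upsilon> admissible_crossing in auto)

text \<open>There are only finitely many critical points. Within distance \<open>r\<close> of
  \<open>x0\<close>, in the sum norm, the signs of the coordinates are those of \<open>x0\<close>
  and no other critical point occurs.\<close>

lemma critical_radius:
  assumes e: "e \<in> expanding_pairs A" and x0: "critical_point p A e x0"
  obtains r where "0 < r" "\<And>i. i \<le> p \<Longrightarrow> r \<le> \<bar>x0 i\<bar>"
    "\<And>e' y. \<lbrakk>e' \<in> expanding_pairs A; critical_point p A e' y; y \<noteq> x0\<rbrakk> \<Longrightarrow> r \<le> (\<Sum>i\<le>p. \<bar>y i - x0 i\<bar>)"
proof -
  define Y where "Y = {y. \<exists>e' \<in> expanding_pairs A. critical_point p A e' y}"
  define R where "R = (\<lambda>i. \<bar>x0 i\<bar>) ` {..p} \<union> (\<lambda>y. \<Sum>i\<le>p. \<bar>y i - x0 i\<bar>) ` (Y - {x0})"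
  have "Y \<subseteq> (\<lambda>e'. SOME y. critical_point p A e' y) ` expanding_pairs A"
  proof
    fix y assume "y \<in> Y"
    then obtain e' where e': "e' \<in> expanding_pairs A" "critical_point p A e' y"
      by (auto simp: Y_def)
    then have "critical_point p A e' (SOME y. critical_point p A e' y)"
      by (metis someI)
    then have "y = (SOME y. critical_point p A e' y)"
      using critical_point_unique[OF A gen] expanding_pairsD[OF A gen e'(1)] e'(2) by simp
    then show "y \<in> (\<lambda>e'. SOME y. critical_point p A e' y) ` expanding_pairs A"
      using e'(1) by blast
  qed
  then have "finite Y"
    using finite_expanding_pairs[OF A] finite_surj by blast
  then have R: "finite R" "R \<noteq> {}"
    by (auto simp: R_def)
  have "0 < c" if "c \<in> R" for c
    using that unfolding R_def
  proof (elim UnE imageE)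
    fix i assume "c = \<bar>x0 i\<bar>" "i \<in> {..p}"
    then show "0 < c"
      using x0 by (auto simp: critical_point_def)
  next
    fix y assume c: "c = (\<Sum>i\<le>p. \<bar>y i - x0 i\<bar>)" and y: "y \<in> Y - {x0}"
    have "c \<noteq> 0"
    proof
      assume "c = 0"
      then have "\<forall>i\<le>p. y i = x0 i"
        using c by (simp add: sum_nonneg_eq_0_iff)
      moreover have "\<forall>i>p. y i = x0 i"
        using y x0 by (auto simp: Y_def critical_point_def in_nsphere_iff)
      ultimately have "y = x0"
        by (intro ext) (metis linorder_not_le)
      then show False
        using y by simp
    qed
    then show "0 < c"
      using c by (simp add: less_le sum_nonneg)
  qed
  then have "0 < Min R"
    using R by simp
  moreover have "Min R \<le> \<bar>x0 i\<bar>" if "i \<le> p" for i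
    using that R by (intro Min_le) (auto simp: R_def)
  moreover have "Min R \<le> (\<Sum>i\<le>p. \<bar>y i - x0 i\<bar>)"
    if "e' \<in> expanding_pairs A" "critical_point p A e' y" "y \<noteq> x0" for e' y
    using that R by (intro Min_le) (auto simp: R_def Y_def)
  ultimately show ?thesis
    by (rule that)
qed

text \<open>The witness is \<open>\<tau>1\<close>, which is \<open>\<tau>\<close> flattened to
  \<open>t1\<close> near \<open>x0\<close>. A bump at \<open>x0\<close> turns it into
  \<open>\<tau>2\<close>, which crosses the same pairs as \<open>\<tau>\<close>, and locality
  compares \<open>\<tau>1\<close> and \<open>\<tau>2\<close> with two models whose degrees are
  known.\<close>

lemma degree_of_crossing_insert:
  assumes e: "e \<in> expanding_pairs A" "e \<notin> J" and \<tau>: "crossing \<tau> (insert e J)"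
  shows "\<exists>\<upsilon>. crossing \<upsilon> J \<and> real_of_int (degree_of p (abs_pencil p A \<tau>)) =
    real_of_int (degree_of p (abs_pencil p A \<upsilon>)) - sgn (poly (pderiv (char_poly (snd e * A))) (fst e))"
proof -
  define \<mu> S where "\<mu> = fst e" and "S = snd e"
  note E = expanding_pairsD[OF A gen e(1), folded \<mu>_def S_def]
  obtain x0 where x0: "critical_point p A e x0"
    using E(4) by blast
  then have x0_sphere: "x0 \<in> topspace (nsphere p)"
    by (simp add: critical_point_def)
  obtain r where r: "0 < r" "\<And>i. i \<le> p \<Longrightarrow> r \<le> \<bar>x0 i\<bar>"
    "\<And>e' y. \<lbrakk>e' \<in> expanding_pairs A; critical_point p A e' y; y \<noteq> x0\<rbrakk> \<Longrightarrow> r \<le> (\<Sum>i\<le>p. \<bar>y i - x0 i\<bar>)"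
    using critical_radius[OF e(1) x0] by blast
  define B where "B = A * S"
  have B: "B \<in> carrier_mat (Suc p) (Suc p)"
    using A sign_matsD(1)[OF E(2)] by (auto simp: B_def)
  have char_B: "char_poly B = char_poly (S * A)"
    unfolding B_def using char_poly_sign_commute[OF E(2) A] by simp
  then have simple: "simple_eigenvalue B \<mu>"
    using E(3) by (simp add: simple_eigenvalue_def)
  obtain t1 t2 where t: "0 < t1" "t1 < 1 / \<mu>" "1 / \<mu> < t2" "t2 \<le> 1"
    and det: "\<And>t. \<lbrakk>t1 \<le> t; t \<le> t2; t \<noteq> 1 / \<mu>\<rbrakk> \<Longrightarrow> det (1\<^sub>m (Suc p) - t \<cdot>\<^sub>m B) \<noteq> 0"
    and sgn_det: "sgn (det (1\<^sub>m (Suc p) - t1 \<cdot>\<^sub>m B)) = sgn (poly (pderiv (char_poly B)) \<mu>)"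
    using pencil_sign_change[OF B simple E(1)] by blast
  define d where "d x = (\<Sum>i\<le>p. \<bar>x i - x0 i\<bar>)" for x
  have d_ge: "\<bar>x i - x0 i\<bar> \<le> d x" if "i \<le> p" for x i
    unfolding d_def using that by (intro member_le_sum) auto
  have d_cont: "continuous_map (nsphere p) euclideanreal d"
    unfolding d_def[abs_def]
    by (intro continuous_map_sum continuous_map_real_abs continuous_map_diff continuous_map_nsphere_projection) auto
  have near: "\<bar>x i\<bar> = S $$ (i, i) * x i" if "d x < r" "i \<le> p" for x i
  proof -
    have "\<bar>x i - x0 i\<bar> < \<bar>x0 i\<bar>"
      using that r(2) d_ge by (meson le_less_trans less_le_trans)
    moreover have "\<bar>x0 i\<bar> = S $$ (i, i) * x0 i"
      using critical_point_abs[OF x0] E(2) that(2) by (simp add: S_def)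
    moreover have "S $$ (i, i) = 1 \<or> S $$ (i, i) = - 1"
      using sign_matsD(3)[OF E(2)] that(2) by simp
    ultimately show ?thesis
      by auto
  qed
  have act_near: "act p A (\<lambda>j. \<bar>x j\<bar>) i = act p B x i" if "d x < r" "i \<le> p" for x i
    unfolding B_def act_mult_sign(1)[OF E(2) A that(2)] using near[OF that(1)] by (intro act_cong) auto
  have d0: "d x0 = 0"
    by (simp add: d_def)
  \<comment> \<open>A plateau \<open>q\<close>, equal to 1 for \<open>d x \<le> r / 2\<close> and 0
    from \<open>r\<close> on, and a bump \<open>b\<close> with value 1 at \<open>x0\<close> that
    vanishes from \<open>r / 4\<close> on, well inside the plateau.\<close>
  define q b where "q x = max 0 (min 1 (2 - 2 / r * d x))" and "b x = max 0 (1 - 4 / r * d x)" for x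
  have cont_qb: "continuous_map (nsphere p) euclideanreal q" "continuous_map (nsphere p) euclideanreal b"
    unfolding q_def[abs_def] b_def[abs_def]
    by (intro continuous_map_real_max continuous_map_real_min continuous_map_diff continuous_map_real_mult_left d_cont; simp)+
  have d_nonneg: "0 \<le> d x" for x
    by (simp add: d_def sum_nonneg)
  have q01: "0 \<le> q x" "q x \<le> 1" and b01: "0 \<le> b x" "b x \<le> 1" for x
    using d_nonneg[of x] r(1) by (auto simp: q_def b_def)
  have q1: "q x = 1" if "d x \<le> r / 2" for x
    using that r(1) by (simp add: q_def field_simps)
  have q0: "q x = 0" if "r \<le> d x" for x
    using that r(1) by (simp add: q_def field_simps)
  have b0: "b x = 0" if "r / 4 \<le> d x" for x
    using that r(1) by (simp add: b_def field_simps)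
  \<comment> \<open>On the plateau \<open>\<tau>1\<close> is the constant \<open>t1\<close> and
    \<open>\<tau>2\<close> equals \<open>\<sigma>\<close>; the model parameters \<open>t1\<close>
    and \<open>\<sigma>\<close> make sense on the whole sphere.\<close>
  define \<tau>1 \<sigma> \<tau>2 where "\<tau>1 x = (1 - q x) * \<tau> x + q x * t1" and "\<sigma> x = t1 + (t2 - t1) * b x"
    and "\<tau>2 x = \<tau>1 x + (t2 - t1) * b x" for x
  have \<sigma>_range: "t1 \<le> \<sigma> x" "\<sigma> x \<le> t2" for x
  proof -
    show "t1 \<le> \<sigma> x"
      using t b01[of x] by (simp add: \<sigma>_def)
    have "(t2 - t1) * b x \<le> (t2 - t1) * 1"
      using t b01[of x] by (intro mult_left_mono) auto
    then show "\<sigma> x \<le> t2"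
      by (simp add: \<sigma>_def)
  qed
  have cont: "continuous_map (nsphere p) euclideanreal \<tau>1" "continuous_map (nsphere p) euclideanreal \<tau>2"
    "continuous_map (nsphere p) euclideanreal \<sigma>"
    using \<tau> unfolding \<tau>1_def[abs_def] \<tau>2_def[abs_def] \<sigma>_def[abs_def] crossing_def
    by (auto intro!: continuous_map_add continuous_map_real_mult continuous_map_diff cont_qb)
  have \<tau>1_range: "0 \<le> \<tau>1 x" "\<tau>1 x \<le> 1" if x: "x \<in> topspace (nsphere p)" for x
  proof -
    have "0 \<le> \<tau> x" "\<tau> x \<le> 1"
      using \<tau> x by (auto simp: crossing_def)
    then show "0 \<le> \<tau>1 x" "\<tau>1 x \<le> 1"
      using q01[of x] t unfolding \<tau>1_def by (auto intro!: convex_bound_le)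
  qed
  have \<tau>2_cases: "\<tau>2 x = \<sigma> x \<or> \<tau>2 x = \<tau>1 x" for x
    using q1[of x] b0[of x] r(1) by (cases "d x \<le> r / 2") (auto simp: \<tau>2_def \<tau>1_def \<sigma>_def)
  have at_x0: "\<tau>1 x0 = t1" "\<tau>2 x0 = t2" "\<sigma> x0 = t2"
    using d0 r(1) by (simp_all add: \<tau>1_def \<tau>2_def \<sigma>_def q_def b_def)
  \<comment> \<open>Uniqueness and injectivity of critical points: a change confined to distance
    less than \<open>r\<close> from \<open>x0\<close> affects the pair \<open>e\<close>
    only.\<close>
  have at_e: "y = x0 \<longleftrightarrow> e' = e" if "e' \<in> expanding_pairs A" "critical_point p A e' y" for e' y
    using that x0 critical_point_inj[of e p e' A] critical_point_unique[OF A gen, of e x0 y] E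
      expanding_pairsD[OF A gen that(1)] by (auto simp: S_def \<mu>_def)
  have away: "\<tau>1 y = \<tau> y" "\<tau>2 y = \<tau> y" if "e' \<in> expanding_pairs A" "critical_point p A e' y" "y \<noteq> x0" for e' y
  proof -
    have "r \<le> d y"
      using r(3)[OF that] by (simp add: d_def)
    then show "\<tau>1 y = \<tau> y" "\<tau>2 y = \<tau> y"
      using r(1) q0 b0[of y] by (simp_all add: \<tau>1_def \<tau>2_def)
  qed
  have crossing1: "crossing \<tau>1 J"
    unfolding crossing_def
  proof (intro conjI ballI allI impI cont \<tau>1_range)
    fix e' y assume e': "e' \<in> expanding_pairs A" and y: "critical_point p A e' y"
    show "\<tau>1 y \<noteq> 1 / fst e'" "1 / fst e' < \<tau>1 y \<longleftrightarrow> e' \<in> J"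
      using \<tau> e' y away[OF e' y] at_e[OF e' y] at_x0(1) t(2) e(2) unfolding crossing_def
      by (cases "e' = e"; auto simp: \<mu>_def)+
  qed
  have crossing2: "crossing \<tau>2 (insert e J)"
    unfolding crossing_def
  proof (intro conjI ballI allI impI cont)
    show "0 \<le> \<tau>2 x" "\<tau>2 x \<le> 1" if "x \<in> topspace (nsphere p)" for x
      using \<tau>2_cases[of x] \<tau>1_range[OF that] \<sigma>_range[of x] t by auto
    fix e' y assume e': "e' \<in> expanding_pairs A" and y: "critical_point p A e' y"
    show "\<tau>2 y \<noteq> 1 / fst e'" "1 / fst e' < \<tau>2 y \<longleftrightarrow> e' \<in> insert e J"
      using \<tau> e' y away[OF e' y] at_e[OF e' y] at_x0(2) t(3) unfolding crossing_def
      by (cases "e' = e"; auto simp: \<mu>_def)+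
  qed
  have B_x0: "act p B x0 i = \<mu> * x0 i" if "i \<le> p" for i
    using act_near[of x0 i] d0 r(1) that x0 by (simp add: critical_point_def \<mu>_def)
  let ?M = "1\<^sub>m (Suc p) - t1 \<cdot>\<^sub>m B" and ?g = "\<lambda>x i. x i - \<sigma> x * act p B x i"
  have M: "?M \<in> carrier_mat (Suc p) (Suc p)" "det ?M \<noteq> 0"
    using B det[of t1] t by auto
  have adm_g: "admissible p ?g"
    unfolding admissible_def
  proof (intro conjI allI impI ballI continuous_map_pencil(2) cont(3), rule ccontr)
    fix x assume x: "x \<in> topspace (nsphere p)" and "\<not> (\<exists>i\<le>p. ?g x i \<noteq> 0)"
    then have zero: "x i = \<sigma> x * act p B x i" if "i \<le> p" for i
      using that by simp
    obtain k where k: "k \<le> p" "x k \<noteq> 0"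
      using nsphere_nonzero[OF x] .
    \<comment> \<open>A zero needs \<open>\<sigma> x = 1 / \<mu>\<close>, hence a nonzero bump.
      There \<open>B\<close> agrees with \<open>A\<close> applied to absolute values, so the zero is
      a critical point within \<open>r\<close> of \<open>x0\<close>, hence \<open>x0\<close> itself,
      where \<open>\<sigma>\<close> is \<open>t2\<close>.\<close>
    have crit: "\<sigma> x = 1 / \<mu>"
      using pencil_kernel[OF B _ zero k(1)] det[OF \<sigma>_range] k(2) by blast
    then have "b x \<noteq> 0"
      using t by (auto simp: \<sigma>_def)
    then have dx: "d x < r"
      using b0[of x] r(1) by linarith
    have "x i = \<sigma> x * act p A (\<lambda>j. \<bar>x j\<bar>) i" if "i \<le> p" for i
      using zero[OF that] act_near[OF dx that] by simp
    then obtain e' where e': "e' \<in> expanding_pairs A" "critical_point p A e' x"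
      using zero_imp_critical_point[OF A gen spec x, of "\<sigma> x"] \<sigma>_range[of x] t by auto
    then have "x = x0"
      using r(3) dx unfolding d_def by fastforce
    then show False
      using at_x0(3) crit t(3) by simp
  qed
  \<comment> \<open>Already coordinate 0 puts the antipode at distance at least
    \<open>2 * r\<close>, outside the bump.\<close>
  have antipode: "\<sigma> (\<lambda>i. - x0 i) = t1"
  proof -
    have "r / 4 \<le> d (\<lambda>i. - x0 i)"
      using d_ge[of 0 "\<lambda>i. - x0 i"] r(1) r(2)[of 0] by simp
    then show ?thesis
      by (simp add: \<sigma>_def b0)
  qed
  have deg_g: "degree_of p ?g = 0"
  proof (rule degree_of_pencil_one_pole[OF B simple _ x0_sphere B_x0])
    show "det (1\<^sub>m (Suc p) - \<sigma> x \<cdot>\<^sub>m B) \<noteq> 0" if "\<sigma> x \<noteq> 1 / \<mu>" for x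
      using det[OF \<sigma>_range that] .
  qed (use E(1) at_x0(3) antipode t adm_g in auto)
  have "degree_of p (abs_pencil p A \<tau>1) - degree_of p (abs_pencil p A \<tau>2) = degree_of p (act p ?M) - degree_of p ?g"
  proof (rule degree_of_local)
    \<comment> \<open>On \<open>?U\<close> the plateau identifies each map with its linear model; on
      \<open>?W\<close> the bump vanishes, so the two members of each pair coincide.\<close>
    let ?U = "{x \<in> topspace (nsphere p). d x \<in> {..<r / 2}}" and ?W = "{x \<in> topspace (nsphere p). d x \<in> {r / 4<..}}"
    show "openin (nsphere p) ?U" "openin (nsphere p) ?W"
      by (intro openin_continuous_map_preimage[OF d_cont]; simp)+
    show "topspace (nsphere p) \<subseteq> ?U \<union> ?W"
      using r(1) by auto
    show "abs_pencil p A \<tau>1 x i = act p ?M x i" if "x \<in> ?U" "i \<le> p" for x i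
      using that q1[of x] act_near[of x i] r(1) act_pencil[OF B] by (simp add: abs_pencil_def \<tau>1_def)
    show "abs_pencil p A \<tau>2 x i = ?g x i" if "x \<in> ?U" "i \<le> p" for x i
      using that q1[of x] act_near[of x i] r(1) by (simp add: abs_pencil_def \<tau>2_def \<tau>1_def \<sigma>_def)
    show "abs_pencil p A \<tau>1 x i = abs_pencil p A \<tau>2 x i" if "x \<in> ?W" "i \<le> p" for x i
      using that b0[of x] by (simp add: abs_pencil_def \<tau>2_def)
    show "act p ?M x i = ?g x i" if "x \<in> ?W" "i \<le> p" for x i
      using that b0[of x] act_pencil[OF B] by (simp add: \<sigma>_def)
  qed (use admissible_crossing crossing1 crossing2 admissible_act[OF M] adm_g in auto)
  moreover have "real_of_int (degree_of p (act p ?M)) = sgn (poly (pderiv (char_poly (S * A))) \<mu>)"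
    using degree_of_act[OF M] sgn_det char_B by simp
  ultimately have "real_of_int (degree_of p (abs_pencil p A \<tau>2)) =
      real_of_int (degree_of p (abs_pencil p A \<tau>1)) - sgn (poly (pderiv (char_poly (S * A))) \<mu>)"
    using deg_g by linarith
  then show ?thesis
    using crossing1 degree_of_crossing_cong[OF \<tau> crossing2] by (auto simp: \<mu>_def S_def)
qed

text \<open>Induction over the crossed pairs. For none, \<open>\<tau>\<close> can be replaced by the
  constant 0, which gives the identity.\<close>

lemma degree_of_crossing:
  assumes "finite J" "J \<subseteq> expanding_pairs A" "crossing \<tau> J"
  shows "real_of_int (degree_of p (abs_pencil p A \<tau>)) =
    1 - (\<Sum>e\<in>J. sgn (poly (pderiv (char_poly (snd e * A))) (fst e)))"
  using assms
proof (induction J arbitrary: \<tau> rule: finite_induct)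
  case empty
  have "crossing (\<lambda>_. 0) {}"
    using expanding_pairsD(1)[OF A gen] by (force simp: crossing_def)
  then have "degree_of p (abs_pencil p A \<tau>) = degree_of p (abs_pencil p A (\<lambda>_. 0))"
    using empty degree_of_crossing_cong by blast
  also have "\<dots> = degree_of p (\<lambda>x. x)"
    by (intro degree_of_cong) (simp add: abs_pencil_def)
  finally show ?case
    by (simp add: degree_of_id)
next
  case (insert e J)
  obtain \<upsilon> where "crossing \<upsilon> J" "real_of_int (degree_of p (abs_pencil p A \<tau>)) =
      real_of_int (degree_of p (abs_pencil p A \<upsilon>)) - sgn (poly (pderiv (char_poly (snd e * A))) (fst e))"
    using degree_of_crossing_insert[of e J \<tau>] insert.hyps insert.prems by auto
  then show ?case
    using insert by simp
qed

lemma crossing_all: "crossing (\<lambda>_. 1) (expanding_pairs A)"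
  using expanding_pairsD(1)[OF A gen] by (force simp: crossing_def)

section \<open>Identification of the pencil at parameter 1 with the original map\<close>

lemma F_map_index:
  assumes "i \<le> p"
  shows "F_map A (vec (Suc p) x) $ i = abs_pencil p A (\<lambda>_. 1) x i"
proof -
  have "map_vec abs (vec (Suc p) x) = vec (Suc p) (\<lambda>j. \<bar>x j\<bar>)"
    by auto
  then show ?thesis
    using A assms by (simp add: F_map_def abs_pencil_def act_index[OF A assms] del: index_mult_mat_vec)
qed

text \<open>By positive homogeneity a nonzero zero could be scaled onto the sphere, where the
  constant parameter 1 admits none.\<close>

lemma nondegenerate: "nondegenerate_F A"
  unfolding nondegenerate_F_def
proof (intro ballI impI, rule ccontr)
  fix z assume z: "z \<in> carrier_vec (dim_row A)" "F_map A z = 0\<^sub>v (dim_row A)" "z \<noteq> 0\<^sub>v (dim_row A)"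
  define u where "u i = z $ i" for i
  have n: "dim_row A = Suc p"
    using A by simp
  have vec: "z = vec (Suc p) u"
    using z(1) n by (auto simp: u_def)
  obtain k where k: "k \<le> p" "u k \<noteq> 0"
    using z(3) unfolding vec n by (metis index_vec index_zero_vec eq_vecI dim_vec less_Suc_eq_le)
  define N where "N = L2_set u {..p}"
  have N: "0 < N"
    using L2_set_atMost_pos k by (auto simp: N_def)
  define x where "x i = (if i \<le> p then (1 / N) * u i else 0)" for i
  have "(\<Sum>i\<le>p. (x i)\<^sup>2) = (\<Sum>i\<le>p. (u i)\<^sup>2) / N\<^sup>2"
    by (simp add: x_def power_divide sum_divide_distrib)
  also have "\<dots> = 1"
    using N by (simp add: N_def L2_set_def sum_nonneg)
  finally have x: "x \<in> topspace (nsphere p)"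
    by (auto simp: in_nsphere_iff x_def)
  have "abs_pencil p A (\<lambda>_. 1) x i = 0" if i: "i \<le> p" for i
  proof -
    have "act p A (\<lambda>j. \<bar>x j\<bar>) i = act p A (\<lambda>j. (1 / N) * \<bar>u j\<bar>) i"
      using N by (intro act_cong) (simp add: x_def)
    then have "abs_pencil p A (\<lambda>_. 1) x i = (1 / N) * abs_pencil p A (\<lambda>_. 1) u i"
      using i unfolding abs_pencil_def act_scale by (simp add: x_def diff_divide_distrib)
    also have "abs_pencil p A (\<lambda>_. 1) u i = 0"
      using z(2) i unfolding vec F_map_index[OF i, symmetric] n by simp
    finally show ?thesis
      by simp
  qed
  then show False
    using crossing_nonzero[OF crossing_all x] by blast
qed

lemma deg_F_eq: "deg_F A = degree_of p (abs_pencil p A (\<lambda>_. 1))"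
proof -
  have dim: "dim_row A = Suc p" "dim_vec (F_map A (vec (Suc p) x)) = Suc p" for x
    using A by (auto simp: F_map_def)
  have "norm2 (F_map A (vec (Suc p) x)) = L2_set (abs_pencil p A (\<lambda>_. 1) x) {..p}" for x
    unfolding norm2_def dim lessThan_Suc_atMost by (intro L2_set_cong) (auto simp: F_map_index)
  then have "F_sphere_map A = normalise p (abs_pencil p A (\<lambda>_. 1))"
    by (auto simp: F_sphere_map_def normalise_def Let_def dim F_map_index less_Suc_eq_le fun_eq_iff)
  then show ?thesis
    by (simp add: deg_F_def degree_of_def dim)
qed

end

theorem theorem1p4:
  fixes A :: "real mat" and n :: nat
  assumes "0 < n" and "A \<in> carrier_mat n n"
    and "generic A"
    and "1 \<notin> aligned_spectrum A"
  shows "nondegenerate_F A \<and>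
    real_of_int (deg_F A) =
      1 - (\<Sum>(\<mu>, S) \<in> expanding_pairs A. sgn (poly (pderiv (char_poly (S * A))) \<mu>))"
proof -
  \<comment> \<open>The locale is indexed by the dimension \<open>p\<close> of the sphere, one less
    than the size of the matrix.\<close>
  obtain p where n: "n = Suc p"
    using assms(1) gr0_implies_Suc by blast
  interpret generic_matrix p A
    using assms n by unfold_locales auto
  have "finite (expanding_pairs A)"
    using finite_expanding_pairs assms(1,2) by blast
  then show ?thesis
    using nondegenerate deg_F_eq degree_of_crossing[OF _ order_refl crossing_all]
    by (simp add: case_prod_unfold)
qed

end
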